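(* Let $w,v$ be nonnegative integers, $(\ell_1,\dots,\ell_w)$ a $w$-tuple of positive integers, and $(v_1,\dots,v_w)$ a tuple of integers with $0\le v_j\le\ell_j$ for all $j$ and $\sum_{j=1}^wv_j=v$. Then $$\tilde W_{(v_1,\dots,v_w)}:=\sum_{c\in\mathcal C_{(v_1,\dots,v_w)}}F(c)=\Big(\prod_{j=1}^w(-1)^{v_j\left(v+w-j-\sum_{s=1}^jv_s\right)}(2\hbar)^{v_j}\frac{\ell_j!}{(\ell_j-v_j)!}\Big)\,W^{\mathrm{id}}_{(v_1,\dots,v_w)}.$$
   Context: **Lattice model.** Consider a $v\times w$ rectangular grid (planar graph with external edges included), columns numbered $1,\dots,w$ from left to right and rows $1,\dots,v$ from top to bottom. A state $c\in\mathcal C_{(v_1,\dots,v_w)}$ is a labelling of all edges such that: (i) labels of horizontal edges are in $\{0,1\}$; (ii) labels of vertical edges in column $j$ are in $\{0,1,\dots,\ell_j\}$; (iii) external edges have fixed labels: $0$ on the South and East sides, $1$ on the West side, and $v_j$ on the North side in column $j$; (iv) at each vertex, (left label)+(bottom label)=(right label)+(top label). The weight of $c$ is $F(c)=\prod_{i=1}^v\prod_{j=1}^wf^{(\ell_j)}(c(i,j),y_i-z_j)\in\mathbb{C}[\hbar,y_1,\dots,y_v,z_1,\dots,z_w]$, where $c(i,j)$ is the configuration of labels around the vertex in row $i$, column $j$, and, $m$ being the label of the bottom edge, - left $=0$, right $=0$, top $=m$: $f^{(l)}(\cdot,u)=u-(l-2m)\hbar$; - left $=1$, right $=1$, top $=m$: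 $f^{(l)}(\cdot,u)=u+(l-2m)\hbar$; - left $=0$, right $=1$, top $=m-1$: $f^{(l)}(\cdot,u)=2m\hbar$; - left $=1$, right $=0$, top $=m+1$: $f^{(l)}(\cdot,u)=2(l-m)\hbar$. **Weight function.** $W^{\mathrm{id}}_{(v_1,\dots,v_w)}$ (the image of $1\otimes\cdots\otimes1$ under the framed shuffle product) is explicitly $$W^{\mathrm{id}}_{(v_1,\dots,v_w)}=\sum_{(I_1,\dots,I_w)}\ \prod_{1\le t<s\le w}\ \prod_{i\in I_s,\,k\in I_t}\frac{y_i-y_k-2\hbar}{y_k-y_i}\ \cdot\prod_{1\le s<a\le w}\ \prod_{i\in I_s}(z_a-y_i+\ell_a\hbar)\ \cdot\prod_{1\le a<s\le w}\ \prod_{i\in I_s}(y_i-z_a+\ell_a\hbar),$$ the sum being over all ordered set partitions $I_1\sqcup\cdots\sqcup I_w=\{1,\dots,v\}$ with $|I_j|=v_j$. *)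

theory Defs
  imports
    Complex_Main
    "HOL-Library.Poly_Mapping"
    "HOL-Library.FuncSet"
    "HOL-Computational_Algebra.Polynomial_Factorial"
begin

section \<open>The polynomial ring and its field of fractions\<close>

datatype indet = Hbar | Y nat | Z nat

text \<open>
  The linear order on indeterminates carries no mathematical content. It is needed only because
  the library derives the class \<open>idom\<close> for rings of finitely supported functions from an ordered
  monoid of exponents.
\<close>

fun indet_index :: "indet \<Rightarrow> nat" where
  "indet_index Hbar = 0"
| "indet_index (Y i) = 2 * i + 1"
| "indet_index (Z j) = 2 * j + 2"

lemma indet_index_inject: "indet_index a = indet_index b \<Longrightarrow> a = b"
  by (cases a; cases b; simp; presburger)

instantiation indet :: linorder
begin

definition less_eq_indet :: "indet \<Rightarrow> indet \<Rightarrow> bool"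
  where "a \<le> b \<longleftrightarrow> indet_index a \<le> indet_index b"

definition less_indet :: "indet \<Rightarrow> indet \<Rightarrow> bool"
  where "a < b \<longleftrightarrow> indet_index a < indet_index b"

instance
  by standard (auto simp: less_eq_indet_def less_indet_def intro: indet_index_inject)

end

text \<open>
  A monomial is its finitely supported exponent function, and a polynomial its finitely supported
  coefficient function; the multiplication of \<open>poly_mapping\<close> is convolution. This is the ring of
  complex polynomials in \<open>\<hbar>\<close>, \<open>y\<^sub>i\<close>, \<open>z\<^sub>j\<close> for all natural numbers \<open>i\<close>, \<open>j\<close>, which contains the
  polynomial ring of every grid size.
\<close>

type_synonym mpoly = "(indet \<Rightarrow>\<^sub>0 nat) \<Rightarrow>\<^sub>0 complex"

definition var :: "indet \<Rightarrow> mpoly"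
  where "var x = Poly_Mapping.single (Poly_Mapping.single x 1) 1"

abbreviation hbar :: mpoly where "hbar \<equiv> var Hbar"
abbreviation yv :: "nat \<Rightarrow> mpoly" where "yv i \<equiv> var (Y i)"
abbreviation zv :: "nat \<Rightarrow> mpoly" where "zv j \<equiv> var (Z j)"


section \<open>The lattice model\<close>

text \<open>
  \<open>Horiz i j\<close> is the edge of row \<open>i\<close> directly to the right of column \<open>j\<close> (so \<open>j = 0\<close> is the West
  external edge and \<open>j = w\<close> the East one). \<open>Vert i j\<close> is the edge of column \<open>j\<close> directly below
  row \<open>i\<close> (so \<open>i = 0\<close> is the North external edge and \<open>i = v\<close> the South one).
\<close>

datatype edge = Horiz nat nat | Vert nat nat

definition edges :: "nat \<Rightarrow> nat \<Rightarrow> edge set"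
  where "edges v w =
    {Horiz i j | i j. i \<in> {1..v} \<and> j \<in> {0..w}} \<union> {Vert i j | i j. i \<in> {0..v} \<and> j \<in> {1..w}}"

fun labels :: "(nat \<Rightarrow> nat) \<Rightarrow> edge \<Rightarrow> nat set" where
  "labels l (Horiz i j) = {0, 1}"
| "labels l (Vert i j) = {0..l j}"

text \<open>
  Labellings are extensional functions (\<open>undefined\<close> off the grid), so each labelling of the edges
  of the grid is counted exactly once.
\<close>

definition states :: "nat \<Rightarrow> nat \<Rightarrow> (nat \<Rightarrow> nat) \<Rightarrow> (nat \<Rightarrow> nat) \<Rightarrow> (edge \<Rightarrow> nat) set"
  where "states v w l vs = {c \<in> Pi\<^sub>E (edges v w) (labels l).
    (\<forall>j\<in>{1..w}. c (Vert v j) = 0) \<and>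
    (\<forall>i\<in>{1..v}. c (Horiz i w) = 0) \<and>
    (\<forall>i\<in>{1..v}. c (Horiz i 0) = 1) \<and>
    (\<forall>j\<in>{1..w}. c (Vert 0 j) = vs j) \<and>
    (\<forall>i\<in>{1..v}. \<forall>j\<in>{1..w}.
      c (Horiz i (j - 1)) + c (Vert i j) = c (Horiz i j) + c (Vert (i - 1) j))}"

text \<open>
  \<open>up\<close> and \<open>m\<close> are the labels of the top and the bottom edge. The final zero is never reached
  at a vertex of a state.
\<close>

definition vertex_weight :: "nat \<Rightarrow> nat \<Rightarrow> nat \<Rightarrow> nat \<Rightarrow> nat \<Rightarrow> mpoly \<Rightarrow> mpoly"
  where "vertex_weight l left right up m u =
    (if left = 0 \<and> right = 0 \<and> up = m then u - (of_nat l - 2 * of_nat m) * hbar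
     else if left = 1 \<and> right = 1 \<and> up = m then u + (of_nat l - 2 * of_nat m) * hbar
     else if left = 0 \<and> right = 1 \<and> up + 1 = m then 2 * of_nat m * hbar
     else if left = 1 \<and> right = 0 \<and> up = m + 1 then 2 * (of_nat l - of_nat m) * hbar
     else 0)"

definition state_weight :: "nat \<Rightarrow> nat \<Rightarrow> (nat \<Rightarrow> nat) \<Rightarrow> (edge \<Rightarrow> nat) \<Rightarrow> mpoly"
  where "state_weight v w l c =
    (\<Prod>i\<in>{1..v}. \<Prod>j\<in>{1..w}.
      vertex_weight (l j) (c (Horiz i (j - 1))) (c (Horiz i j)) (c (Vert (i - 1) j)) (c (Vert i j))
        (yv i - zv j))"

definition partition_function :: "nat \<Rightarrow> nat \<Rightarrow> (nat \<Rightarrow> nat) \<Rightarrow> (nat \<Rightarrow> nat) \<Rightarrow> mpoly"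
  where "partition_function v w l vs = (\<Sum>c\<in>states v w l vs. state_weight v w l c)"


section \<open>The weight function\<close>

definition ordered_set_partitions :: "nat \<Rightarrow> nat \<Rightarrow> (nat \<Rightarrow> nat) \<Rightarrow> (nat \<Rightarrow> nat set) set"
  where "ordered_set_partitions v w vs = {I \<in> {1..w} \<rightarrow>\<^sub>E Pow {1..v}.
    (\<Union>j\<in>{1..w}. I j) = {1..v} \<and>
    (\<forall>s\<in>{1..w}. \<forall>t\<in>{1..w}. s \<noteq> t \<longrightarrow> I s \<inter> I t = {}) \<and>
    (\<forall>j\<in>{1..w}. card (I j) = vs j)}"

text \<open>
  The individual summands have genuine denominators, so the sum is formed in the field of
  fractions. The denominators are non-zero because distinct blocks of a partition are disjoint.
\<close>

definition weight_function :: "nat \<Rightarrow> nat \<Rightarrow> (nat \<Rightarrow> nat) \<Rightarrow> (nat \<Rightarrow> nat) \<Rightarrow> mpoly fract"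
  where "weight_function v w l vs =
    (\<Sum>I\<in>ordered_set_partitions v w vs.
      (\<Prod>t\<in>{1..w}. \<Prod>s\<in>{t<..w}. \<Prod>i\<in>I s. \<Prod>k\<in>I t.
         to_fract (yv i - yv k - 2 * hbar) / to_fract (yv k - yv i)) *
      (\<Prod>s\<in>{1..w}. \<Prod>a\<in>{s<..w}. \<Prod>i\<in>I s. to_fract (zv a - yv i + of_nat (l a) * hbar)) *
      (\<Prod>a\<in>{1..w}. \<Prod>s\<in>{a<..w}. \<Prod>i\<in>I s. to_fract (yv i - zv a + of_nat (l a) * hbar)))"

end

theory Submission
  imports Defs
begin

text \<open>
  The idea is to peel the lattice off column by column, from East to West, and to see that each
  step is the step that adds one more block to an ordered set partition. Work over a field and
  allow the horizontal edges on the East boundary to carry arbitrary labels. As a function of the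
  rows (each with its spectral parameter and its East label) the partition function of \<open>w\<close> columns
  satisfies an exchange relation: swapping two adjacent rows mixes the labels \<open>1, 0\<close> and \<open>0, 1\<close> by
  the rational six-vertex R-matrix. This holds because one column intertwines the R-matrix
  (\<open>column_exchange_head\<close>, the Yang--Baxter equation of the model) and because the West boundary,
  where every label is \<open>1\<close>, is an eigenvector of it.

  Exchange relations move every row with East label \<open>1\<close> below all rows with East label \<open>0\<close>
  (\<open>move_one_down\<close>). There such rows are frozen: the South labels vanish, so a row with \<open>1\<close> on both
  sides passes straight through and contributes the product of \<open>y i - z a + l a * h\<close> over the columns
  (\<open>grid_frozen_rows\<close>). Hence the partition function of \<open>w\<close> columns with any East boundary is a
  combination of partition functions with zero East boundary on subsets of the rows.

  Now let the East boundary of \<open>w + 1\<close> columns be zero. In the last column the rows that enter with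
  label \<open>1\<close> form a subset of size \<open>k = vs (w + 1)\<close>, and the column weight is an explicit product.
  Inserting the combination above and collecting the coefficient of each \<open>k\<close>-subset \<open>R\<close> gives
  (\<open>column_zero_east\<close>) the single product over \<open>j\<close> outside \<open>R\<close> of
  \<open>y j - z (w + 1) - l (w + 1) * h\<close> times the factors \<open>(y r - y j - 2 * h) / (y r - y j)\<close> for \<open>r\<close> in
  \<open>R\<close>. The collapse to one product is the partial fraction identity \<open>exchange_sum_identity\<close>. This is
  the recursion of the weight function with \<open>R\<close> as the last block \<open>I (w + 1)\<close>
  (\<open>weight_term_Suc\<close>, \<open>sum_block_partitions_Suc\<close>), and the signs that separate the two products are
  those of the prefactor. Induction on \<open>w\<close> finishes the computation in \<open>grid_zero_east\<close>.
\<close>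

section \<open>A partial fraction identity\<close>

text \<open>
  Adding a pole \<open>y a\<close> multiplies the product by \<open>1 + e / (x - y a)\<close>; products of two simple
  fractions split again, and the residue at the new pole is the identity for the old poles at
  \<open>x = y a\<close>.
\<close>
lemma partial_fractions:
  fixes y :: "'b \<Rightarrow> 'a::field"
  assumes "finite R" "inj_on y R" "x \<notin> y ` R"
  shows "(\<Prod>i\<in>R. 1 + e / (x - y i)) =
    1 + (\<Sum>j\<in>R. e / (x - y j) * (\<Prod>i\<in>R - {j}. 1 + e / (y j - y i)))"
  using assms
proof (induction R arbitrary: x rule: finite_induct)
  case (insert a R)
  define c where "c j = (\<Prod>i\<in>R - {j}. 1 + e / (y j - y i))" for j
  have ne: "x - y a \<noteq> 0" "\<And>j. j \<in> R \<Longrightarrow> x - y j \<noteq> 0" "\<And>j. j \<in> R \<Longrightarrow> y j - y a \<noteq> 0"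
    using insert.prems insert.hyps by (auto simp: inj_on_def)
  have Px: "(\<Prod>i\<in>R. 1 + e / (x - y i)) = 1 + (\<Sum>j\<in>R. e / (x - y j) * c j)"
    unfolding c_def using insert.prems by (intro insert.IH) auto
  have Pa: "(\<Prod>i\<in>R. 1 + e / (y a - y i)) = 1 + (\<Sum>j\<in>R. e / (y a - y j) * c j)"
    unfolding c_def using insert.prems insert.hyps by (intro insert.IH) auto
  have c': "(\<Prod>i\<in>insert a R - {j}. 1 + e / (y j - y i)) = (1 + e / (y j - y a)) * c j" if "j \<in> R" for j
  proof -
    have "insert a R - {j} = insert a (R - {j})" using that insert.hyps by auto
    then show ?thesis using insert.hyps by (simp add: c_def)
  qed
  have split: "e / (x - y j) * ((1 + e / (y j - y a)) * c j) =
      e / (x - y j) * c j * (1 + e / (x - y a)) - e / (x - y a) * (e / (y a - y j) * c j)"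
    if "j \<in> R" for j
  proof -
    have "y a - y j \<noteq> 0" using ne(3)[OF that] by auto
    then show ?thesis using ne(1) ne(2,3)[OF that] by (simp add: divide_simps) (simp add: algebra_simps)
  qed
  have "insert a R - {a} = R" using insert.hyps by auto
  then have "(\<Sum>j\<in>insert a R. e / (x - y j) * (\<Prod>i\<in>insert a R - {j}. 1 + e / (y j - y i))) =
     e / (x - y a) * (\<Prod>i\<in>R. 1 + e / (y a - y i)) + (\<Sum>j\<in>R. e / (x - y j) * ((1 + e / (y j - y a)) * c j))"
    using insert.hyps by (simp add: c')
  also have "(\<Sum>j\<in>R. e / (x - y j) * ((1 + e / (y j - y a)) * c j)) =
      (\<Sum>j\<in>R. e / (x - y j) * c j) * (1 + e / (x - y a)) -
      e / (x - y a) * (\<Sum>j\<in>R. e / (y a - y j) * c j)"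
    unfolding sum_distrib_left sum_distrib_right sum_subtractf[symmetric]
    by (intro sum.cong refl split)
  also have "e / (x - y a) * (\<Prod>i\<in>R. 1 + e / (y a - y i)) + \<dots> =
      e / (x - y a) + (\<Sum>j\<in>R. e / (x - y j) * c j) * (1 + e / (x - y a))"
    unfolding Pa by (simp only: distrib_left mult_1_right) simp
  finally show ?case using insert.hyps by (simp add: Px algebra_simps)
qed simp

text \<open>
  This compares the coefficients of \<open>1 / x\<close> at infinity in \<open>partial_fractions\<close>. The induction avoids
  the limit: the sum of the old residues drops by exactly the amount by which the residue at a new
  pole \<open>y a\<close> exceeds \<open>e\<close>.
\<close>
lemma residue_sum:
  fixes y :: "'b \<Rightarrow> 'a::field"
  assumes "finite R" "inj_on y R"
  shows "(\<Sum>j\<in>R. e * (\<Prod>i\<in>R - {j}. 1 + e / (y j - y i))) = of_nat (card R) * e"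
  using assms
proof (induction R rule: finite_induct)
  case (insert a R)
  define c where "c j = (\<Prod>i\<in>R - {j}. 1 + e / (y j - y i))" for j
  have c': "(\<Prod>i\<in>insert a R - {j}. 1 + e / (y j - y i)) = (1 + e / (y j - y a)) * c j" if "j \<in> R" for j
  proof -
    have "insert a R - {j} = insert a (R - {j})" using that insert.hyps by auto
    then show ?thesis using insert.hyps by (simp add: c_def)
  qed
  have Pa: "(\<Prod>i\<in>R. 1 + e / (y a - y i)) = 1 + (\<Sum>j\<in>R. e / (y a - y j) * c j)"
    unfolding c_def using insert.prems insert.hyps by (intro partial_fractions) auto
  have split: "e * ((1 + e / (y j - y a)) * c j) = e * c j - e * (e / (y a - y j) * c j)" for j
  proof -
    have "e / (y j - y a) = - (e / (y a - y j))" by (metis minus_diff_eq minus_divide_right)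
    then show ?thesis by (simp add: algebra_simps)
  qed
  have IH: "(\<Sum>j\<in>R. e * c j) = of_nat (card R) * e"
    unfolding c_def using insert by auto
  have "insert a R - {a} = R" using insert.hyps by auto
  then have "(\<Sum>j\<in>insert a R. e * (\<Prod>i\<in>insert a R - {j}. 1 + e / (y j - y i))) =
     e * (\<Prod>i\<in>R. 1 + e / (y a - y i)) + (\<Sum>j\<in>R. e * ((1 + e / (y j - y a)) * c j))"
    using insert.hyps by (simp add: c')
  also have "\<dots> = e + of_nat (card R) * e"
    unfolding Pa split sum_subtractf IH by (simp add: sum_distrib_left algebra_simps)
  finally show ?case using insert.hyps by (simp add: algebra_simps)
qed simp

text \<open>
  Multiplying the partial fraction expansion by \<open>x - q = (x - y j) + (y j - q)\<close> turns the first
  part of each term into a residue, and the residues add up to \<open>card R * e\<close>.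
\<close>
lemma exchange_sum_identity:
  fixes y :: "'b \<Rightarrow> 'a::field"
  assumes "finite R" "inj_on y R" "x \<notin> y ` R"
  shows "(x - q) * (\<Prod>i\<in>R. 1 + e / (x - y i)) =
    (x - q) + of_nat (card R) * e +
    (\<Sum>j\<in>R. e / (x - y j) * (y j - q) * (\<Prod>i\<in>R - {j}. 1 + e / (y j - y i)))"
proof -
  define c where "c j = (\<Prod>i\<in>R - {j}. 1 + e / (y j - y i))" for j
  have "(x - q) * (e / (x - y j) * c j) = e * c j + e / (x - y j) * (y j - q) * c j" if "j \<in> R" for j
  proof -
    have "x - y j \<noteq> 0" using assms(3) that by auto
    then show ?thesis by (simp add: divide_simps) (simp add: algebra_simps)
  qed
  then show ?thesis
    unfolding partial_fractions[OF assms] c_def[symmetric]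
    using residue_sum[OF assms(1,2), of e]
    by (simp add: distrib_left sum_distrib_left sum.distrib c_def)
qed

section \<open>The transfer through one column\<close>

text \<open>
  The exchange relation has the denominators \<open>y i - y j\<close>, so the model is treated over a field with
  arbitrary, pairwise distinct row parameters.
\<close>
locale lattice_model =
  fixes h :: "'a::field" and y z :: "nat \<Rightarrow> 'a" and l :: "nat \<Rightarrow> nat"
  assumes inj_y: "inj y"
begin

definition wt :: "nat \<Rightarrow> nat \<Rightarrow> nat \<Rightarrow> nat \<Rightarrow> nat \<Rightarrow> nat \<Rightarrow> 'a" where
  "wt c i left right up m =
    (if left = 0 \<and> right = 0 \<and> up = m then y i - z c - (of_nat (l c) - 2 * of_nat m) * h
     else if left = 1 \<and> right = 1 \<and> up = m then y i - z c + (of_nat (l c) - 2 * of_nat m) * h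
     else if left = 0 \<and> right = 1 \<and> up + 1 = m then 2 * of_nat m * h
     else if left = 1 \<and> right = 0 \<and> up = m + 1 then 2 * (of_nat (l c) - of_nat m) * h
     else 0)"

text \<open>
  A list of pairs \<open>(i, b)\<close> describes the rows from North to South: \<open>i\<close> selects the spectral
  parameter and \<open>b\<close> is a horizontal label. The list given to \<open>column\<close> has the labels to the East of
  the column, the lists given to \<open>X\<close> have those to the West, and \<open>t\<close> is the label on top. The
  functional \<open>X\<close> collects the West labels as the recursion descends, so that \<open>column\<close> needs no
  explicit sum over all West boundaries. The bottom label is forced to be \<open>0\<close> at the South end, and
  vertical labels are not bounded by \<open>l c\<close> here: a path that exceeds the bound has weight \<open>0\<close>
  (\<open>path_weight_exceed\<close>).
\<close>
fun column :: "nat \<Rightarrow> ((nat \<times> nat) list \<Rightarrow> 'a) \<Rightarrow> nat \<Rightarrow> (nat \<times> nat) list \<Rightarrow> 'a" where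
  "column c X t [] = (if t = 0 then X [] else 0)"
| "column c X t ((i, b) # r) = (\<Sum>a\<in>{0, 1}. if a \<le> t + b
     then wt c i a b t (t + b - a) * column c (\<lambda>s. X ((i, a) # s)) (t + b - a) r else 0)"

text \<open>
  The partition function of the first \<open>w\<close> columns, with top labels \<open>vs\<close> and the East boundary in
  the row list; the base case states that all labels of the West boundary are \<open>1\<close>.
\<close>
fun grid :: "(nat \<Rightarrow> nat) \<Rightarrow> nat \<Rightarrow> (nat \<times> nat) list \<Rightarrow> 'a" where
  "grid vs 0 r = (if \<forall>p\<in>set r. snd p = 1 then 1 else 0)"
| "grid vs (Suc w) r = column (Suc w) (grid vs w) (vs (Suc w)) r"

section \<open>The exchange relation\<close>

text \<open>
  The first two relations are the scalar entries of the R-matrix. In the third, interchanging the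
  roles of \<open>i\<close> and \<open>j\<close> gives the value at \<open>(j, 1) # (i, 0)\<close>, so that the two functionals on
  \<open>(0, 1)\<close> determine the two on \<open>(1, 0)\<close>. With the denominator
  \<open>y i - y j\<close> cleared the relation also holds, trivially, for \<open>i = j\<close>.
\<close>
definition exchange :: "((nat \<times> nat) list \<Rightarrow> 'a) \<Rightarrow> bool" where
  "exchange X \<longleftrightarrow>
    (\<forall>p r i j. X (p @ (i, 0) # (j, 0) # r) = X (p @ (j, 0) # (i, 0) # r)) \<and>
    (\<forall>p r i j. X (p @ (i, 1) # (j, 1) # r) = X (p @ (j, 1) # (i, 1) # r)) \<and>
    (\<forall>p r i j. (y i - y j) * X (p @ (i, 1) # (j, 0) # r) =
      (y i - y j - 2 * h) * X (p @ (j, 0) # (i, 1) # r) + 2 * h * X (p @ (i, 0) # (j, 1) # r))"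

lemma exchange_Cons:
  assumes "exchange X" shows "exchange (\<lambda>s. X (q # s))"
proof -
  have "X (p' @ (i, 0) # (j, 0) # r) = X (p' @ (j, 0) # (i, 0) # r)"
    "X (p' @ (i, 1) # (j, 1) # r) = X (p' @ (j, 1) # (i, 1) # r)"
    "(y i - y j) * X (p' @ (i, 1) # (j, 0) # r) =
      (y i - y j - 2 * h) * X (p' @ (j, 0) # (i, 1) # r) + 2 * h * X (p' @ (i, 0) # (j, 1) # r)"
    if "p' = q # p" for p' p r i j
    using assms by (auto simp: exchange_def)
  then show ?thesis unfolding exchange_def by (metis append_Cons)
qed

lemma column_add: "column c (\<lambda>s. X s + X' s) t r = column c X t r + column c X' t r"
proof (induction r arbitrary: X X' t)
  case (Cons p r) then show ?case by (cases p) (simp add: algebra_simps)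
qed simp

lemma column_scale: "column c (\<lambda>s. q * X s) t r = q * column c X t r"
proof (induction r arbitrary: X t)
  case (Cons p r) then show ?case by (cases p) (simp add: algebra_simps)
qed simp

text \<open>
  This is the Yang--Baxter equation for one column and two rows at the top. The number of ones among
  the two West labels is preserved by the exchange, so every path below the two rows starts from
  the same label, and the claims reduce to finitely many polynomial identities in the vertex weights.
\<close>
lemma column_exchange_head:
  assumes "exchange X"
  shows "column c X t ((i, 0) # (j, 0) # r) = column c X t ((j, 0) # (i, 0) # r)" (is ?A)
    and "column c X t ((i, 1) # (j, 1) # r) = column c X t ((j, 1) # (i, 1) # r)" (is ?B)
    and "(y i - y j) * column c X t ((i, 1) # (j, 0) # r) =
      (y i - y j - 2 * h) * column c X t ((j, 0) # (i, 1) # r)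
      + 2 * h * column c X t ((i, 0) # (j, 1) # r)" (is ?C)
proof -
  define Q where "Q a b i j n = column c (\<lambda>s. X ((i, a) # (j, b) # s)) n r" for a b i j n
  have X: "X ((i, 0) # (j, 0) # r) = X ((j, 0) # (i, 0) # r)"
    "X ((i, 1) # (j, 1) # r) = X ((j, 1) # (i, 1) # r)"
    "(y i - y j) * X ((i, 1) # (j, 0) # r) =
      (y i - y j - 2 * h) * X ((j, 0) # (i, 1) # r) + 2 * h * X ((i, 0) # (j, 1) # r)" for i j r
    using assms append_Nil unfolding exchange_def by metis+
  have Q0: "Q 0 0 i j n = Q 0 0 j i n" and Q1: "Q (Suc 0) (Suc 0) i j n = Q (Suc 0) (Suc 0) j i n" for n
    unfolding Q_def using X(1,2)[of i j] by simp_all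
  have Q: "(y i - y j) * Q (Suc 0) 0 i j n =
      (y i - y j - 2 * h) * Q 0 (Suc 0) j i n + 2 * h * Q 0 (Suc 0) i j n" for i j n
    unfolding Q_def column_scale[symmetric] column_add[symmetric] X(3)[of i j, unfolded One_nat_def] ..
  have "?A \<and> ?B \<and> ?C"
  proof (cases "i = j")
    case False
    then have d: "y i - y j \<noteq> 0" "y j - y i \<noteq> 0" using inj_y by (auto simp: inj_def)
    \<comment> \<open>Division by \<open>y i - y j\<close> turns the claims into polynomial identities in free parameters.\<close>
    define P where "P a b n = Q 0 (Suc 0) a b n / (y i - y j)" for a b n
    have Q01: "Q 0 (Suc 0) a b n = (y i - y j) * P a b n" for a b n
      unfolding P_def using d by simp
    have Q10: "Q (Suc 0) 0 i j n = (y i - y j - 2 * h) * P j i n + 2 * h * P i j n"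
      "Q (Suc 0) 0 j i n = (y i - y j + 2 * h) * P i j n - 2 * h * P j i n" for n
    proof -
      have "(y i - y j) * Q (Suc 0) 0 i j n = (y i - y j) * ((y i - y j - 2 * h) * P j i n + 2 * h * P i j n)"
        unfolding Q Q01 by algebra
      then show "Q (Suc 0) 0 i j n = (y i - y j - 2 * h) * P j i n + 2 * h * P i j n"
        using d by simp
      have "(y j - y i) * Q (Suc 0) 0 j i n = (y j - y i) * ((y i - y j + 2 * h) * P i j n - 2 * h * P j i n)"
        unfolding Q Q01 by algebra
      then show "Q (Suc 0) 0 j i n = (y i - y j + 2 * h) * P i j n - 2 * h * P j i n"
        using d by simp
    qed
    note S = wt_def Q_def[symmetric] Q0 Q1 Q01 Q10
    \<comment> \<open>The weights depend on whether the top label leaves room for one or two ones on the West.\<close>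
    have ?A
    proof (cases t)
      case (Suc t')
      then show ?thesis by (cases t') (simp_all add: S algebra_simps)
    qed (simp add: S)
    moreover have ?B by (cases t) (simp_all add: S algebra_simps)
    moreover have ?C by (cases t) (simp_all add: S algebra_simps)
    ultimately show ?thesis by blast
  qed simp
  then show ?A ?B ?C by auto
qed


text \<open>
  A row above the swapped pair contributes the same factor to both orders, and prefixing it to the
  arguments of the West functional leaves an exchange functional (\<open>exchange_Cons\<close>).
\<close>
lemma column_exchange:
  assumes "exchange X" shows "exchange (column c X t)"
proof -
  have "column c X t (p @ (i, 0) # (j, 0) # r) = column c X t (p @ (j, 0) # (i, 0) # r) \<and>
      column c X t (p @ (i, 1) # (j, 1) # r) = column c X t (p @ (j, 1) # (i, 1) # r) \<and>
      (y i - y j) * column c X t (p @ (i, 1) # (j, 0) # r) =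
      (y i - y j - 2 * h) * column c X t (p @ (j, 0) # (i, 1) # r)
      + 2 * h * column c X t (p @ (i, 0) # (j, 1) # r)" for p i j r
    using assms
  proof (induction p arbitrary: X t)
    case Nil
    then show ?case using column_exchange_head by (metis append_Nil)
  next
    case (Cons q p)
    obtain k b where q: "q = (k, b)" by (cases q)
    define K where "K a s = (if a \<le> t + b then wt c k a b t (t + b - a) *
      column c (\<lambda>s. X ((k, a) # s)) (t + b - a) s else 0)" for a s
    have K: "K a (p @ (i, 0) # (j, 0) # r) = K a (p @ (j, 0) # (i, 0) # r) \<and>
      K a (p @ (i, 1) # (j, 1) # r) = K a (p @ (j, 1) # (i, 1) # r) \<and>
      (y i - y j) * K a (p @ (i, 1) # (j, 0) # r) =
      (y i - y j - 2 * h) * K a (p @ (j, 0) # (i, 1) # r) + 2 * h * K a (p @ (i, 0) # (j, 1) # r)" for a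
      using Cons.IH[OF exchange_Cons[OF Cons.prems], of "(k, a)" "t + b - a"]
      unfolding K_def by (auto simp: mult.left_commute[of _ "wt _ _ _ _ _ _"] simp flip: distrib_left)
    have col: "column c X t ((k, b) # s) = K 0 s + K 1 s" for s
      by (simp add: K_def)
    show ?case
      unfolding q append_Cons col distrib_left using K[of 0] K[of 1] by (simp only: ac_simps)
  qed
  then show ?thesis unfolding exchange_def by blast
qed

lemma grid_exchange: "exchange (grid vs w)"
proof (induction w)
  case (Suc w)
  have "grid vs (Suc w) = column (Suc w) (grid vs w) (vs (Suc w))" by (rule ext) simp
  then show ?case using column_exchange[OF Suc] by simp
qed (auto simp: exchange_def)

section \<open>Rows frozen at the bottom\<close>

text \<open>
  Below the last row the vertical label is \<open>0\<close>. If the East label is \<open>1\<close>, a West label \<open>0\<close> would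
  leave a positive label at the bottom, so the West label is \<open>1\<close> and the top label \<open>0\<close>.
\<close>
lemma column_frozen_row:
  "column c X t (r @ [(i, 1)]) =
    (y i - z c + of_nat (l c) * h) * column c (\<lambda>s. X (s @ [(i, 1)])) t r"
proof (induction r arbitrary: X t)
  case Nil
  show ?case by (simp add: wt_def)
next
  case (Cons p r)
  obtain k b where "p = (k, b)" by (cases p)
  then show ?case by (simp add: Cons[unfolded One_nat_def] algebra_simps)
qed

lemma grid_frozen_row:
  "grid vs w (r @ [(i, 1)]) = (\<Prod>c\<in>{1..w}. y i - z c + of_nat (l c) * h) * grid vs w r"
proof (induction w arbitrary: r)
  case (Suc w)
  have "grid vs w (s @ [(i, 1)]) = (\<Prod>c\<in>{1..w}. y i - z c + of_nat (l c) * h) * grid vs w s" for s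
    by (rule Suc)
  then show ?case
    by (simp add: column_frozen_row[unfolded One_nat_def] column_scale)
qed simp

abbreviation rows :: "nat \<Rightarrow> nat list \<Rightarrow> (nat \<times> nat) list" where
  "rows b is \<equiv> map (\<lambda>i. (i, b)) is"

lemma grid_frozen_rows:
  assumes "distinct bs"
  shows "grid vs w (r @ rows 1 bs) =
    (\<Prod>i\<in>set bs. \<Prod>c\<in>{1..w}. y i - z c + of_nat (l c) * h) * grid vs w r"
  using assms
proof (induction bs rule: rev_induct)
  case (snoc b bs)
  then show ?case
    using grid_frozen_row[of vs w "r @ rows 1 bs" b] by (simp add: ac_simps)
qed simp

section \<open>Moving a one to the bottom\<close>

text \<open>
  Exchanging a row \<open>i\<close> with label \<open>1\<close> and the row \<open>j\<close> with label \<open>0\<close> below it, the label either hops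
  down together with its row, or the rows stay and the label is passed on to row \<open>j\<close>.
\<close>
definition hop :: "nat \<Rightarrow> nat \<Rightarrow> 'a" where "hop i j = (y i - y j - 2 * h) / (y i - y j)"
definition pass :: "nat \<Rightarrow> nat \<Rightarrow> 'a" where "pass i j = 2 * h / (y i - y j)"

lemma exchange_step:
  assumes "exchange X" "i \<noteq> j"
  shows "X ((i, 1) # (j, 0) # r) = hop i j * X ((j, 0) # (i, 1) # r) + pass i j * X ((i, 0) # (j, 1) # r)"
proof -
  have d: "y i - y j \<noteq> 0" using inj_y assms(2) by (auto simp: inj_def)
  have "(y i - y j) * X ((i, 1) # (j, 0) # r) =
      (y i - y j - 2 * h) * X ((j, 0) # (i, 1) # r) + 2 * h * X ((i, 0) # (j, 1) # r)"
    using assms(1) append_Nil unfolding exchange_def by metis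
  then show ?thesis using d unfolding hop_def pass_def by (simp add: divide_simps) (simp add: ac_simps)
qed

text \<open>
  The label of row \<open>i\<close> can reach row \<open>s\<close> past row \<open>j\<close> in two ways, staying with \<open>i\<close> or being handed to
  \<open>j\<close> on the way; this adds them up.
\<close>
lemma three_term:
  assumes "i \<noteq> j" "i \<noteq> s" "j \<noteq> s"
  shows "hop i j * pass i s + pass i j * pass j s = pass i s * hop s j"
proof -
  have "y i - y j \<noteq> 0" "y i - y s \<noteq> 0" "y j - y s \<noteq> 0" "y s - y j \<noteq> 0"
    using inj_y assms by (auto simp: inj_def)
  then show ?thesis unfolding hop_def pass_def by (simp add: divide_simps) (simp add: algebra_simps)
qed

text \<open>
  The standard step of the algebraic Bethe ansatz. Either row \<open>i\<close> itself arrives at the bottom, or the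
  label ends in some other row \<open>s\<close>. The exact order of the rows with label \<open>0\<close> on the right-hand side
  is immaterial, as they may be permuted freely.
\<close>
lemma move_one_down:
  assumes "exchange X" "distinct (i # is)"
  shows "X ((i, 1) # rows 0 is @ r) =
    (\<Prod>j\<in>set is. hop i j) * X (rows 0 is @ (i, 1) # r) +
    (\<Sum>s\<in>set is. pass i s * (\<Prod>j\<in>set is - {s}. hop s j) * X (rows 0 (i # remove1 s is) @ (s, 1) # r))"
  using assms
proof (induction "is" arbitrary: i X)
  case (Cons j "is")
  let ?T = "\<lambda>s. X ((j, 0) # rows 0 (i # remove1 s is) @ (s, 1) # r)"
  have ij: "i \<noteq> j" "j \<notin> set is" "i \<notin> set is" using Cons.prems by auto
  note ex = exchange_Cons[OF Cons.prems(1)]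
  have swap: "X ((i, 0) # (j, 0) # q) = X ((j, 0) # (i, 0) # q)" for q
    using Cons.prems(1) append_Nil unfolding exchange_def by metis
  have 1: "X ((j, 0) # (i, 1) # rows 0 is @ r) =
    (\<Prod>j\<in>set is. hop i j) * X ((j, 0) # rows 0 is @ (i, 1) # r) +
    (\<Sum>s\<in>set is. pass i s * (\<Prod>j\<in>set is - {s}. hop s j) * ?T s)"
    using Cons.IH[OF ex[of "(j, 0)"], of i] Cons.prems by simp
  have 2: "X ((i, 0) # (j, 1) # rows 0 is @ r) =
    (\<Prod>s\<in>set is. hop j s) * X ((i, 0) # rows 0 is @ (j, 1) # r) +
    (\<Sum>s\<in>set is. pass j s * (\<Prod>j\<in>set is - {s}. hop s j) * ?T s)"
    using Cons.IH[OF ex[of "(i, 0)"], of j] Cons.prems by (simp add: swap)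
  have 3: "hop i j * (pass i s * (\<Prod>j\<in>set is - {s}. hop s j) * ?T s) +
      pass i j * (pass j s * (\<Prod>j\<in>set is - {s}. hop s j) * ?T s) =
      pass i s * (\<Prod>j\<in>set (j # is) - {s}. hop s j) * X (rows 0 (i # remove1 s (j # is)) @ (s, 1) # r)"
    if "s \<in> set is" for s
  proof -
    have "s \<noteq> j" "i \<noteq> s" using that ij by auto
    moreover have "set (j # is) - {s} = insert j (set is - {s})" using \<open>s \<noteq> j\<close> by auto
    ultimately have p: "(\<Prod>j\<in>set (j # is) - {s}. hop s j) = hop s j * (\<Prod>j\<in>set is - {s}. hop s j)"
      using ij by simp
    have x: "X (rows 0 (i # remove1 s (j # is)) @ (s, 1) # r) = ?T s"
      using \<open>s \<noteq> j\<close> swap by simp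
    show ?thesis unfolding p x mult.assoc[symmetric]
      using three_term[OF \<open>i \<noteq> j\<close> \<open>i \<noteq> s\<close> \<open>s \<noteq> j\<close>[symmetric]]
      by (metis (no_types, lifting) distrib_right mult.assoc)
  qed
  have sj: "set (j # is) - {j} = set is" using ij by auto
  have "X ((i, 1) # rows 0 (j # is) @ r) =
      hop i j * X ((j, 0) # (i, 1) # rows 0 is @ r) + pass i j * X ((i, 0) # (j, 1) # rows 0 is @ r)"
    using exchange_step[OF Cons.prems(1) \<open>i \<noteq> j\<close>] by simp
  also have "\<dots> = hop i j * (\<Prod>j\<in>set is. hop i j) * X ((j, 0) # rows 0 is @ (i, 1) # r) +
     pass i j * (\<Prod>s\<in>set is. hop j s) * X ((i, 0) # rows 0 is @ (j, 1) # r) +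
     (\<Sum>s\<in>set is. hop i j * (pass i s * (\<Prod>j\<in>set is - {s}. hop s j) * ?T s) +
      pass i j * (pass j s * (\<Prod>j\<in>set is - {s}. hop s j) * ?T s))"
    unfolding 1 2 sum.distrib sum_distrib_left distrib_left by (simp only: ac_simps)
  also have "(\<Sum>s\<in>set is. hop i j * (pass i s * (\<Prod>j\<in>set is - {s}. hop s j) * ?T s) +
      pass i j * (pass j s * (\<Prod>j\<in>set is - {s}. hop s j) * ?T s)) =
    (\<Sum>s\<in>set is. pass i s * (\<Prod>j\<in>set (j # is) - {s}. hop s j) *
       X (rows 0 (i # remove1 s (j # is)) @ (s, 1) # r))"
    by (rule sum.cong[OF refl 3])
  finally show ?case
    using ij sj by (simp add: add.assoc)
qed simp

end

section \<open>A column with zero East boundary\<close>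
lemma sum_subsets_move:
  assumes "finite U" "Suc k = n"
  shows "(\<Sum>R | R \<subseteq> U \<and> card R = k. \<Sum>j\<in>U - R. F R j) =
    (\<Sum>R | R \<subseteq> U \<and> card R = n. \<Sum>j\<in>R. F (R - {j}) j)"
proof -
  have fin: "finite {R. R \<subseteq> U \<and> card R = m}" for m using assms(1) by simp
  have fR: "finite R" if "R \<subseteq> U" for R using that assms(1) finite_subset by blast
  have "(\<Sum>R | R \<subseteq> U \<and> card R = k. \<Sum>j\<in>U - R. F R j) =
    (\<Sum>(R, j)\<in>(SIGMA R:{R. R \<subseteq> U \<and> card R = k}. U - R). F R j)"
    using assms(1) fin by (intro sum.Sigma) auto
  also have "\<dots> = (\<Sum>(R, j)\<in>(SIGMA R:{R. R \<subseteq> U \<and> card R = n}. R). F (R - {j}) j)"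
    by (rule sum.reindex_bij_witness[where i = "\<lambda>(R, j). (R - {j}, j)" and j = "\<lambda>(R, j). (insert j R, j)"])
      (use assms fR in \<open>auto simp: insert_absorb card_insert_if\<close>)
  also have "\<dots> = (\<Sum>R | R \<subseteq> U \<and> card R = n. \<Sum>j\<in>R. F (R - {j}) j)"
    using fR fin by (intro sum.Sigma[symmetric]) auto
  finally show ?thesis .
qed

lemma sum_subsets_insert:
  assumes "finite U" "i \<notin> U"
  shows "(\<Sum>R | R \<subseteq> insert i U \<and> card R = n. F R) =
    (\<Sum>R | R \<subseteq> U \<and> card R = n. F R) +
    (if n = 0 then 0 else \<Sum>R | R \<subseteq> U \<and> card R = n - 1. F (insert i R))"
proof (cases n)
  case 0
  have "{R. R \<subseteq> insert i U \<and> card R = 0} = {{}}" "{R. R \<subseteq> U \<and> card R = 0} = {{}}"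
    using assms(1) by (auto simp: card_eq_0_iff dest: infinite_super)
  then show ?thesis using 0 by simp
next
  case (Suc k)
  have fR: "finite R" if "R \<subseteq> U" for R using that assms(1) finite_subset by blast
  have "{R. R \<subseteq> insert i U \<and> card R = n} =
      {R. R \<subseteq> U \<and> card R = n} \<union> insert i ` {R. R \<subseteq> U \<and> card R = k}" (is "?L = ?A \<union> ?B")
  proof (intro equalityI subsetI)
    fix R assume R: "R \<in> ?L"
    show "R \<in> ?A \<union> ?B"
    proof (cases "i \<in> R")
      case True
      then have "R = insert i (R - {i})" "R - {i} \<subseteq> U" using R by auto
      moreover have "card (R - {i}) = k"
        using R True Suc by (simp add: card_Diff_singleton)
      ultimately show ?thesis by blast
    qed (use R in auto)
  qed (use assms fR Suc in \<open>auto simp: card_insert_if\<close>)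
  moreover have "?A \<inter> ?B = {}" using assms(2) by auto
  moreover have "inj_on (insert i) {R. R \<subseteq> U \<and> card R = k}"
    using assms(2) by (auto simp: inj_on_def)
  ultimately show ?thesis using assms(1) Suc
    by (simp add: sum.union_disjoint sum.reindex)
qed

context lattice_model begin

text \<open>The identity \<open>exchange_sum_identity\<close> at \<open>x = y i\<close> and \<open>e = 2 * h\<close>.\<close>
lemma exchange_sum:
  assumes "finite R" "i \<notin> R"
  shows "(y i - q) * (\<Prod>r\<in>R. hop r i) = (y i - q) + of_nat (card R) * (2 * h) +
    (\<Sum>j\<in>R. pass i j * (y j - q) * (\<Prod>r\<in>R - {j}. hop r j))"
proof -
  have *: "hop r j = 1 + 2 * h / (y j - y r)" if "r \<noteq> j" for r j
  proof -
    have "y r - y j \<noteq> 0" "y j - y r \<noteq> 0" using inj_y that by (auto simp: inj_def)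
    then show ?thesis unfolding hop_def by (simp add: divide_simps) (simp add: algebra_simps)
  qed
  have "(\<Prod>r\<in>R. hop r i) = (\<Prod>r\<in>R. 1 + 2 * h / (y i - y r))"
    using assms(2) by (intro prod.cong refl *) auto
  moreover have "(\<Prod>r\<in>R - {j}. hop r j) = (\<Prod>r\<in>R - {j}. 1 + 2 * h / (y j - y r))" for j
    by (intro prod.cong refl *) auto
  moreover have "inj_on y R" using inj_y by (rule inj_on_subset) simp
  moreover have "y i \<notin> y ` R" using inj_y assms(2) by (auto simp: inj_def)
  ultimately show ?thesis
    using exchange_sum_identity[of R y "y i" q "2 * h"] assms(1) by (simp add: pass_def)
qed

text \<open>
  The induction is on the rows, from North to South. A West label \<open>0\<close> in the first row \<open>i\<close> keeps all
  \<open>k\<close> ones for the rows below and has weight \<open>y i - z c - l c * h + 2 * k * h\<close>. A West label \<open>1\<close> is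
  moved to the bottom, which either puts \<open>i\<close> into the set \<open>R\<close> or puts there some other row \<open>j\<close>
  and makes \<open>i\<close> a row with label \<open>0\<close>. Sets \<open>R\<close> with \<open>i\<close> in \<open>R\<close> receive one contribution, which is
  the claimed product. Sets \<open>R\<close> without \<open>i\<close> receive one from the label \<open>0\<close> and one from every
  \<open>j\<close> in \<open>R\<close>; these combine to the claimed product by \<open>exchange_sum\<close>. The functional \<open>X\<close> enters only
  through its values \<open>\<rho>\<close> on boundaries with all ones at the bottom, as a function of the set of
  rows that carry them.
\<close>
lemma column_zero_east:
  assumes "exchange X" "distinct is"
    and "\<And>as bs. distinct (as @ bs) \<Longrightarrow> set (as @ bs) = set is \<Longrightarrow> length bs = k \<Longrightarrow>
      X (rows 0 as @ rows 1 bs) = \<rho> (set bs)"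
  shows "column c X k (rows 0 is) = (\<Prod>m<k. 2 * (of_nat (l c) - of_nat m) * h) *
    (\<Sum>R | R \<subseteq> set is \<and> card R = k. \<rho> R *
      (\<Prod>j\<in>set is - R. (y j - z c - of_nat (l c) * h) * (\<Prod>r\<in>R. hop r j)))"
  using assms
proof (induction "is" arbitrary: X k \<rho>)
  case Nil
  have 0: "{R. R = {} \<and> card R = 0} = {{}}" and 1: "{R. R = {} \<and> card R = Suc n} = {}" for n
    by auto
  then show ?case using Nil.prems(3)[of "[]" "[]"] by (cases k) (simp_all add: 0 1)
next
  case (Cons i "is")
  define U where "U = set is"
  define u where "u j = y j - z c - of_nat (l c) * h" for j
  define C where "C n = (\<Prod>m<n. 2 * (of_nat (l c) - of_nat m) * h)" for n :: nat
  define G where "G R = (\<Prod>j\<in>U - R. u j * (\<Prod>r\<in>R. hop r j))" for R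
  define X0 X1 where "X0 s = X ((i, 0) # s)" and "X1 s = X ((i, 1) # s)" for s
  \<comment> \<open>What \<open>\<rho>\<close> becomes for the functional \<open>X1\<close> once its leading one has been moved down.\<close>
  define \<rho>1 where "\<rho>1 R = (\<Prod>j\<in>U - R. hop i j) * \<rho> (insert i R) +
      (\<Sum>j\<in>U - R. pass i j * (\<Prod>s\<in>U - R - {j}. hop j s) * \<rho> (insert j R))" for R
  have U: "finite U" "i \<notin> U" "set (i # is) = insert i U" using Cons.prems(2) by (auto simp: U_def)
  have fR: "finite R" if "R \<subseteq> U" for R using that U(1) finite_subset by blast
  have c0: "column c X0 k (rows 0 is) = C k * (\<Sum>R | R \<subseteq> U \<and> card R = k. \<rho> R * G R)"
    unfolding C_def G_def u_def U_def
  proof (rule Cons.IH)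
    show "exchange X0" unfolding X0_def by (rule exchange_Cons[OF Cons.prems(1)])
    show "distinct is" using Cons.prems(2) by simp
    show "X0 (rows 0 as @ rows 1 bs) = \<rho> (set bs)"
      if "distinct (as @ bs)" "set (as @ bs) = set is" "length bs = k" for as bs
    proof -
      have "i \<notin> set as" "i \<notin> set bs" using that(2) Cons.prems(2) by auto
      then show ?thesis
        using Cons.prems(3)[of "i # as" bs] that by (simp add: X0_def)
    qed
  qed
  have c1: "column c X1 k' (rows 0 is) = C k' * (\<Sum>R | R \<subseteq> U \<and> card R = k'. \<rho>1 R * G R)"
    if k': "Suc k' = k" for k'
    unfolding C_def G_def u_def U_def
  proof (rule Cons.IH)
    show "exchange X1" unfolding X1_def by (rule exchange_Cons[OF Cons.prems(1)])
    show "distinct is" using Cons.prems(2) by simp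
    show "X1 (rows 0 as @ rows 1 bs) = \<rho>1 (set bs)"
      if as: "distinct (as @ bs)" "set (as @ bs) = set is" "length bs = k'" for as bs
    proof -
      have i: "i \<notin> set as" "i \<notin> set bs" using as(2) Cons.prems(2) by auto
      have D: "U - set bs = set as" using as(1,2) by (auto simp: U_def)
      have a: "X (rows 0 as @ rows 1 (i # bs)) = \<rho> (insert i (set bs))"
        using Cons.prems(3)[of as "i # bs"] as i k' by auto
      have b: "X (rows 0 (i # remove1 s as) @ rows 1 (s # bs)) = \<rho> (insert s (set bs))"
        if "s \<in> set as" for s
        using Cons.prems(3)[of "i # remove1 s as" "s # bs"] as i k' that by auto
      have "X1 (rows 0 as @ rows 1 bs) = (\<Prod>j\<in>set as. hop i j) * X (rows 0 as @ rows 1 (i # bs)) +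
        (\<Sum>s\<in>set as. pass i s * (\<Prod>j\<in>set as - {s}. hop s j) * X (rows 0 (i # remove1 s as) @ rows 1 (s # bs)))"
        using move_one_down[OF Cons.prems(1), of i as "rows 1 bs"] as i by (simp add: X1_def)
      then show ?thesis unfolding \<rho>1_def D a by (simp add: b[simplified] cong: sum.cong)
    qed
  qed
  have step: "column c X k (rows 0 (i # is)) = (u i + of_nat k * (2 * h)) * column c X0 k (rows 0 is)
     + (if k = 0 then 0 else 2 * (of_nat (l c) - of_nat (k - 1)) * h * column c X1 (k - 1) (rows 0 is))"
    by (cases k) (simp_all add: wt_def X0_def[abs_def] X1_def[abs_def] u_def algebra_simps)
  have Ck: "C k = C (k - 1) * (2 * (of_nat (l c) - of_nat (k - 1)) * h)" if "k \<noteq> 0"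
    using that unfolding C_def by (cases k) simp_all
  have distrib: "x = C' * (q * s + s')" if "x = q * (C' * s) + p * (C'' * s')" "C' = C'' * p"
    for x q s s' p C' C'' :: 'a
    using that by (simp add: algebra_simps)
  have col: "column c X k (rows 0 (i # is)) =
      C k * ((u i + of_nat k * (2 * h)) * (\<Sum>R | R \<subseteq> U \<and> card R = k. \<rho> R * G R) +
        (if k = 0 then 0 else \<Sum>R | R \<subseteq> U \<and> card R = k - 1. \<rho>1 R * G R))"
  proof (cases k)
    case 0
    then show ?thesis using step c0 by simp
  next
    case (Suc k')
    then show ?thesis
      unfolding step c0 using c1[of k'] Ck by (simp only: if_False nat.distinct diff_Suc_1) (rule distrib, simp_all)
  qed
  have G_ins: "(\<Prod>j\<in>insert i U - insert i R. u j * (\<Prod>r\<in>insert i R. hop r j)) = (\<Prod>j\<in>U - R. hop i j) * G R"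
    if "R \<subseteq> U" for R
  proof -
    have "insert i U - insert i R = U - R" "i \<notin> R" using U(2) that by auto
    then show ?thesis using fR[OF that] by (simp add: G_def prod.distrib)
  qed
  have G_not: "(\<Prod>j\<in>insert i U - R. u j * (\<Prod>r\<in>R. hop r j)) = u i * (\<Prod>r\<in>R. hop r i) * G R"
    if "R \<subseteq> U" for R
  proof -
    have "insert i U - R = insert i (U - R)" using U(2) that by auto
    then show ?thesis using U by (simp add: G_def)
  qed
  \<comment> \<open>The factors that appear when the label of row \<open>i\<close> ends in row \<open>j\<close> complete the product for
    \<open>R - {j}\<close> to the one for \<open>R\<close>.\<close>
  have G_move: "(\<Prod>s\<in>U - (R - {j}) - {j}. hop j s) * G (R - {j}) = u j * (\<Prod>r\<in>R - {j}. hop r j) * G R"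
    if "R \<subseteq> U" "j \<in> R" for R j
  proof -
    have 1: "U - (R - {j}) = insert j (U - R)" "insert j (U - R) - {j} = U - R"
      using that by auto
    have "(\<Prod>r\<in>R. hop r s) = hop j s * (\<Prod>r\<in>R - {j}. hop r s)" for s
      using that fR by (simp add: prod.remove)
    then show ?thesis using U(1) that by (simp add: 1 G_def prod.distrib)
  qed
  have \<rho>1_G: "\<rho>1 R * G R = \<rho> (insert i R) * ((\<Prod>j\<in>U - R. hop i j) * G R) +
      (\<Sum>j\<in>U - R. pass i j * \<rho> (insert j R) * ((\<Prod>s\<in>U - R - {j}. hop j s) * G R))" for R
    by (simp add: \<rho>1_def distrib_left sum_distrib_left ac_simps)
  have "(\<Sum>R | R \<subseteq> insert i U \<and> card R = k. \<rho> R * (\<Prod>j\<in>insert i U - R. u j * (\<Prod>r\<in>R. hop r j))) =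
      (\<Sum>R | R \<subseteq> U \<and> card R = k. \<rho> R * (u i * (\<Prod>r\<in>R. hop r i) * G R)) +
      (if k = 0 then 0 else \<Sum>R | R \<subseteq> U \<and> card R = k - 1.
        \<rho> (insert i R) * ((\<Prod>j\<in>U - R. hop i j) * G R))"
  proof -
    have "(\<Sum>R | R \<subseteq> U \<and> card R = k. \<rho> R * (\<Prod>j\<in>insert i U - R. u j * (\<Prod>r\<in>R. hop r j))) =
        (\<Sum>R | R \<subseteq> U \<and> card R = k. \<rho> R * (u i * (\<Prod>r\<in>R. hop r i) * G R))"
      by (intro sum.cong refl arg_cong2[where f = "(*)"] G_not) simp
    moreover have "(\<Sum>R | R \<subseteq> U \<and> card R = n.
          \<rho> (insert i R) * (\<Prod>j\<in>insert i U - insert i R. u j * (\<Prod>r\<in>insert i R. hop r j))) =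
        (\<Sum>R | R \<subseteq> U \<and> card R = n. \<rho> (insert i R) * ((\<Prod>j\<in>U - R. hop i j) * G R))" for n
      by (intro sum.cong refl arg_cong2[where f = "(*)"] G_ins) simp
    ultimately show ?thesis unfolding sum_subsets_insert[OF U(1,2)] by (simp only:)
  qed
  also have "(\<Sum>R | R \<subseteq> U \<and> card R = k. \<rho> R * (u i * (\<Prod>r\<in>R. hop r i) * G R)) =
      (u i + of_nat k * (2 * h)) * (\<Sum>R | R \<subseteq> U \<and> card R = k. \<rho> R * G R) +
      (\<Sum>R | R \<subseteq> U \<and> card R = k. \<Sum>j\<in>R. pass i j * (\<rho> R * (u j * (\<Prod>r\<in>R - {j}. hop r j) * G R)))"
    unfolding sum_distrib_left sum.distrib[symmetric]
  proof (intro sum.cong refl)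
    fix R assume "R \<in> {R. R \<subseteq> U \<and> card R = k}"
    then have "finite R" "i \<notin> R" "card R = k" using fR U by auto
    then have "u i * (\<Prod>r\<in>R. hop r i) = u i + of_nat k * (2 * h) +
        (\<Sum>j\<in>R. pass i j * u j * (\<Prod>r\<in>R - {j}. hop r j))"
      using exchange_sum[of R i "z c + of_nat (l c) * h"] by (simp add: u_def diff_diff_eq)
    then show "\<rho> R * (u i * (\<Prod>r\<in>R. hop r i) * G R) = (u i + of_nat k * (2 * h)) * (\<rho> R * G R) +
        (\<Sum>j\<in>R. pass i j * (\<rho> R * (u j * (\<Prod>r\<in>R - {j}. hop r j) * G R)))"
      by (simp add: distrib_right distrib_left sum_distrib_left sum_distrib_right ac_simps)
  qed
  also have "(\<Sum>R | R \<subseteq> U \<and> card R = k. \<Sum>j\<in>R. pass i j * (\<rho> R * (u j * (\<Prod>r\<in>R - {j}. hop r j) * G R))) =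
      (if k = 0 then 0 else \<Sum>R | R \<subseteq> U \<and> card R = k - 1. \<Sum>j\<in>U - R.
        pass i j * \<rho> (insert j R) * ((\<Prod>s\<in>U - R - {j}. hop j s) * G R))"
  proof (cases k)
    case 0
    have "(\<Sum>R | R \<subseteq> U \<and> card R = k. \<Sum>j\<in>R. F R j) = 0" for F :: "nat set \<Rightarrow> nat \<Rightarrow> 'a"
    proof (rule sum.neutral, rule ballI)
      fix R assume "R \<in> {R. R \<subseteq> U \<and> card R = k}"
      then have "R = {}" using fR[of R] 0 by simp
      then show "(\<Sum>j\<in>R. F R j) = 0" by simp
    qed
    then show ?thesis by (simp only: 0 refl if_True)
  next
    case (Suc k')
    have m: "pass i j * \<rho> (insert j (R - {j})) * ((\<Prod>s\<in>U - (R - {j}) - {j}. hop j s) * G (R - {j})) =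
        pass i j * (\<rho> R * (u j * (\<Prod>r\<in>R - {j}. hop r j) * G R))"
      if "R \<subseteq> U" "j \<in> R" for R j
      unfolding G_move[OF that] insert_Diff[OF that(2)] by (simp only: ac_simps)
    have k: "k \<noteq> 0" "Suc (k - 1) = k" using Suc by auto
    show ?thesis
      unfolding if_not_P[OF k(1)] sum_subsets_move[OF U(1) k(2)]
      by (intro sum.cong refl m[symmetric]) auto
  qed
  finally have main: "(\<Sum>R | R \<subseteq> insert i U \<and> card R = k. \<rho> R * (\<Prod>j\<in>insert i U - R. u j * (\<Prod>r\<in>R. hop r j))) =
      (u i + of_nat k * (2 * h)) * (\<Sum>R | R \<subseteq> U \<and> card R = k. \<rho> R * G R) +
        (if k = 0 then 0 else \<Sum>R | R \<subseteq> U \<and> card R = k - 1. \<rho>1 R * G R)"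
    unfolding \<rho>1_G sum.distrib by (cases k) (simp_all add: add_ac)
  show ?case
    unfolding U(3) col u_def[symmetric] C_def[symmetric] main ..
qed

end

section \<open>Ordered set partitions and the weight function\<close>

text \<open>
  Splitting off the last block leaves a partition of an arbitrary set of rows, not of an initial
  segment of the natural numbers; hence the parameter \<open>S\<close>.
\<close>
definition block_partitions :: "nat set \<Rightarrow> nat \<Rightarrow> (nat \<Rightarrow> nat) \<Rightarrow> (nat \<Rightarrow> nat set) set" where
  "block_partitions S w vs = {I \<in> {1..w} \<rightarrow>\<^sub>E Pow S.
    (\<Union>j\<in>{1..w}. I j) = S \<and>
    (\<forall>s\<in>{1..w}. \<forall>t\<in>{1..w}. s \<noteq> t \<longrightarrow> I s \<inter> I t = {}) \<and>
    (\<forall>j\<in>{1..w}. card (I j) = vs j)}"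

lemma finite_block_partitions: "finite S \<Longrightarrow> finite (block_partitions S w vs)"
  unfolding block_partitions_def by (simp add: finite_PiE)

lemma sum_block_partitions_Suc:
  assumes "finite S"
  shows "(\<Sum>I\<in>block_partitions S (Suc w) vs. F I) =
    (\<Sum>R | R \<subseteq> S \<and> card R = vs (Suc w). \<Sum>J\<in>block_partitions (S - R) w vs. F (J(Suc w := R)))"
proof -
  have iv: "{1..Suc w} = insert (Suc w) {1..w}" by auto
  have "(\<Sum>R | R \<subseteq> S \<and> card R = vs (Suc w). \<Sum>J\<in>block_partitions (S - R) w vs. F (J(Suc w := R))) =
      (\<Sum>(R, J)\<in>(SIGMA R:{R. R \<subseteq> S \<and> card R = vs (Suc w)}. block_partitions (S - R) w vs).
        F (J(Suc w := R)))"
    using assms by (intro sum.Sigma ballI finite_block_partitions) auto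
  also have "\<dots> = (\<Sum>I\<in>block_partitions S (Suc w) vs. F I)"
  proof (rule sum.reindex_bij_witness[where i = "\<lambda>I. (I (Suc w), restrict I {1..w})"
        and j = "\<lambda>(R, J). J(Suc w := R)"])
    fix a assume "a \<in> (SIGMA R:{R. R \<subseteq> S \<and> card R = vs (Suc w)}. block_partitions (S - R) w vs)"
    then obtain R J where a: "a = (R, J)" and R: "R \<subseteq> S" "card R = vs (Suc w)"
      and J: "J \<in> block_partitions (S - R) w vs" by auto
    have ext: "J \<in> extensional {1..w}" using J by (auto simp: block_partitions_def PiE_def)
    have "restrict (J(Suc w := R)) {1..w} = J"
      using ext by (auto simp: restrict_def extensional_def fun_eq_iff)
    then show "((case a of (R, J) \<Rightarrow> J(Suc w := R)) (Suc w),
        restrict (case a of (R, J) \<Rightarrow> J(Suc w := R)) {1..w}) = a"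
      by (simp add: a)
    show "F (case a of (R, J) \<Rightarrow> J(Suc w := R)) = (case a of (R, J) \<Rightarrow> F (J(Suc w := R)))"
      by (simp add: a)
    have JS: "J j \<subseteq> S - R" if "j \<in> {1..w}" for j
      using J that by (auto simp: block_partitions_def PiE_iff)
    have J': "(J(Suc w := R)) j = J j" if "j \<in> {1..w}" for j using that by auto
    have "(\<Union>j\<in>{1..w}. J j) = S - R" using J by (simp add: block_partitions_def)
    then have un: "(\<Union>j\<in>{1..Suc w}. (J(Suc w := R)) j) = S"
      unfolding iv UN_insert SUP_cong[OF refl J'] using R by auto
    have dis: "\<forall>s\<in>{1..Suc w}. \<forall>t\<in>{1..Suc w}. s \<noteq> t \<longrightarrow> (J(Suc w := R)) s \<inter> (J(Suc w := R)) t = {}"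
    proof (intro ballI impI)
      fix s t assume "s \<in> {1..Suc w}" "t \<in> {1..Suc w}" "s \<noteq> t"
      then consider "s = Suc w" "t \<in> {1..w}" | "t = Suc w" "s \<in> {1..w}" | "s \<in> {1..w}" "t \<in> {1..w}"
        unfolding iv by blast
      then show "(J(Suc w := R)) s \<inter> (J(Suc w := R)) t = {}"
      proof cases
        case 1 then show ?thesis using JS[of t] J'[of t] by auto
      next
        case 2 then show ?thesis using JS[of s] J'[of s] by auto
      next
        case 3 then show ?thesis using J \<open>s \<noteq> t\<close> J' by (simp add: block_partitions_def)
      qed
    qed
    have "J(Suc w := R) \<in> {1..Suc w} \<rightarrow>\<^sub>E Pow S"
      unfolding iv using R JS ext by (intro PiE_I) (auto simp: extensional_def)
    moreover have "\<forall>j\<in>{1..Suc w}. card ((J(Suc w := R)) j) = vs j"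
      unfolding iv using J R by (auto simp: block_partitions_def)
    ultimately show "(case a of (R, J) \<Rightarrow> J(Suc w := R)) \<in> block_partitions S (Suc w) vs"
      unfolding a using un dis by (simp add: block_partitions_def del: fun_upd_apply)
  next
    fix I assume I: "I \<in> block_partitions S (Suc w) vs"
    have ext: "I \<in> extensional (insert (Suc w) {1..w})"
      using I unfolding iv[symmetric] by (simp add: block_partitions_def PiE_def)
    have "(restrict I {1..w})(Suc w := I (Suc w)) = I"
      using ext by (auto simp: restrict_def extensional_def fun_eq_iff)
    then show "(case (I (Suc w), restrict I {1..w}) of (R, J) \<Rightarrow> J(Suc w := R)) = I"
      by simp
    have un: "I (Suc w) \<union> (\<Union>j\<in>{1..w}. I j) = S"
      using I unfolding block_partitions_def iv by simp
    have dis: "I s \<inter> I t = {}" if "s \<in> {1..Suc w}" "t \<in> {1..Suc w}" "s \<noteq> t" for s t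
      using I that by (simp add: block_partitions_def)
    have dis': "x \<notin> I (Suc w)" if "j \<in> {1..w}" "x \<in> I j" for j x
      using that dis[of j "Suc w"] by auto
    have "(\<Union>j\<in>{1..w}. restrict I {1..w} j) = S - I (Suc w)" using un dis' by force
    moreover have "\<forall>s\<in>{1..w}. \<forall>t\<in>{1..w}. s \<noteq> t \<longrightarrow> restrict I {1..w} s \<inter> restrict I {1..w} t = {}"
      using dis by simp
    moreover have "restrict I {1..w} \<in> {1..w} \<rightarrow>\<^sub>E Pow (S - I (Suc w))"
      using un dis' by (force simp: PiE_iff)
    moreover have "\<forall>j\<in>{1..w}. card (restrict I {1..w} j) = vs j"
      using I by (simp add: block_partitions_def)
    moreover have "I (Suc w) \<subseteq> S" "card (I (Suc w)) = vs (Suc w)"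
      using I un by (auto simp: block_partitions_def)
    ultimately show "(I (Suc w), restrict I {1..w}) \<in>
        (SIGMA R:{R. R \<subseteq> S \<and> card R = vs (Suc w)}. block_partitions (S - R) w vs)"
      by (simp add: block_partitions_def)
  qed
  finally show ?thesis ..
qed

context lattice_model begin

definition weight_term :: "nat \<Rightarrow> (nat \<Rightarrow> nat set) \<Rightarrow> 'a" where
  "weight_term w I =
    (\<Prod>t\<in>{1..w}. \<Prod>s\<in>{t<..w}. \<Prod>i\<in>I s. \<Prod>k\<in>I t. (y i - y k - 2 * h) / (y k - y i)) *
    (\<Prod>s\<in>{1..w}. \<Prod>a\<in>{s<..w}. \<Prod>i\<in>I s. z a - y i + of_nat (l a) * h) *
    (\<Prod>a\<in>{1..w}. \<Prod>s\<in>{a<..w}. \<Prod>i\<in>I s. y i - z a + of_nat (l a) * h)"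

definition weight_sum :: "nat \<Rightarrow> (nat \<Rightarrow> nat) \<Rightarrow> nat set \<Rightarrow> 'a" where
  "weight_sum w vs S = (\<Sum>I\<in>block_partitions S w vs. weight_term w I)"

text \<open>
  The factors of the weight function that involve the last block \<open>R\<close> or the last column depend on
  the remaining blocks only through their union \<open>S - R\<close>. The signs are those of the weight function:
  its factors are \<open>(y i - y k - 2 * h) / (y k - y i) = - hop i k\<close> and \<open>z a - y i + l a * h\<close>.
\<close>
lemma weight_term_Suc:
  assumes "finite S" "R \<subseteq> S" "J \<in> block_partitions (S - R) w vs"
  shows "weight_term (Suc w) (J(Suc w := R)) = weight_term w J *
    (\<Prod>k\<in>S - R. - (y k - z (Suc w) - of_nat (l (Suc w)) * h) * (\<Prod>i\<in>R. - hop i k)) *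
    (\<Prod>i\<in>R. \<Prod>a\<in>{1..w}. y i - z a + of_nat (l a) * h)"
proof -
  have iv: "{1..Suc w} = insert (Suc w) {1..w}" by auto
  have gt: "{t<..Suc w} = insert (Suc w) {t<..w}" if "t \<in> {1..w}" for t using that by auto
  have nested: "(\<Prod>t\<in>{1..Suc w}. \<Prod>s\<in>{t<..Suc w}. F ((J(Suc w := R)) s) ((J(Suc w := R)) t) t s) =
      (\<Prod>t\<in>{1..w}. F R (J t) t (Suc w)) * (\<Prod>t\<in>{1..w}. \<Prod>s\<in>{t<..w}. F (J s) (J t) t s)"
    for F :: "nat set \<Rightarrow> nat set \<Rightarrow> nat \<Rightarrow> nat \<Rightarrow> 'a"
  proof -
    have "(\<Prod>s\<in>{t<..w}. F ((J(Suc w := R)) s) ((J(Suc w := R)) t) t s) = (\<Prod>s\<in>{t<..w}. F (J s) (J t) t s)"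
      if "t \<in> {1..w}" for t using that by (intro prod.cong) auto
    then show ?thesis
      unfolding iv using gt by (simp add: prod.distrib[symmetric] cong: prod.cong_simp)
  qed
  have fJ: "finite (J t)" if "t \<in> {1..w}" for t
  proof -
    have "J t \<subseteq> S" using assms that by (auto simp: block_partitions_def PiE_iff)
    then show ?thesis using assms(1) finite_subset by blast
  qed
  have un: "(\<Prod>t\<in>{1..w}. \<Prod>k\<in>J t. F k) = (\<Prod>k\<in>S - R. F k)" for F :: "nat \<Rightarrow> 'a"
    using assms fJ prod.UNION_disjoint[of "{1..w}" J F] by (simp add: block_partitions_def)
  have neg_hop: "(y i - y k - 2 * h) / (y k - y i) = - hop i k" for i k
    unfolding hop_def by (metis minus_diff_eq minus_divide_right)
  have "(\<Prod>t\<in>{1..w}. \<Prod>i\<in>R. \<Prod>k\<in>J t. (y i - y k - 2 * h) / (y k - y i)) =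
      (\<Prod>k\<in>S - R. \<Prod>i\<in>R. - hop i k)"
    unfolding neg_hop prod.swap[of _ R] un ..
  moreover have "(\<Prod>t\<in>{1..w}. \<Prod>i\<in>J t. z (Suc w) - y i + of_nat (l (Suc w)) * h) =
      (\<Prod>k\<in>S - R. - (y k - z (Suc w) - of_nat (l (Suc w)) * h))"
    unfolding un by (simp add: algebra_simps)
  moreover have "(\<Prod>a\<in>{1..w}. \<Prod>i\<in>R. y i - z a + of_nat (l a) * h) =
      (\<Prod>i\<in>R. \<Prod>a\<in>{1..w}. y i - z a + of_nat (l a) * h)"
    by (rule prod.swap)
  ultimately show ?thesis
    unfolding weight_term_def prod.distrib
    using nested[of "\<lambda>A B t s. \<Prod>i\<in>A. \<Prod>k\<in>B. (y i - y k - 2 * h) / (y k - y i)"]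
      nested[of "\<lambda>A B t s. \<Prod>i\<in>B. z s - y i + of_nat (l s) * h"]
      nested[of "\<lambda>A B t s. \<Prod>i\<in>A. y i - z t + of_nat (l t) * h"]
    by (simp only: ac_simps)
qed

section \<open>The partition function with zero East boundary\<close>

text \<open>
  The product over \<open>m\<close> is \<open>(2 * h) ^ vs j * l j! / (l j - vs j)!\<close> if \<open>vs j \<le> l j\<close>. In this form it arises from the
  vertices where a label of column \<open>j\<close> drops by one, and it is meaningful in every characteristic.
\<close>
definition prefactor :: "nat \<Rightarrow> (nat \<Rightarrow> nat) \<Rightarrow> 'a" where
  "prefactor w vs = (\<Prod>j\<in>{1..w}.
    (-1) ^ (vs j * ((\<Sum>s\<in>{1..w}. vs s) + w - j - (\<Sum>s\<in>{1..j}. vs s))) *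
    (\<Prod>m<vs j. 2 * (of_nat (l j) - of_nat m) * h))"

text \<open>
  One more column with \<open>k\<close> new rows raises each exponent \<open>vs j * _\<close> by \<open>vs j * (k + 1)\<close>, since \<open>v\<close>
  grows by \<open>k\<close> and \<open>w\<close> by one, while the exponent of the new column itself is \<open>0\<close>.
\<close>
lemma prefactor_Suc:
  "prefactor (Suc w) vs = prefactor w vs *
    (-1) ^ ((\<Sum>s\<in>{1..w}. vs s) * Suc (vs (Suc w))) *
    (\<Prod>m<vs (Suc w). 2 * (of_nat (l (Suc w)) - of_nat m) * h)"
proof -
  define V where "V n = (\<Sum>s\<in>{1..n}. vs s)" for n
  have VS: "V (Suc w) = V w + vs (Suc w)" by (simp add: V_def)
  have V: "V j \<le> V w" if "j \<in> {1..w}" for j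
    unfolding V_def using that by (intro sum_mono2) auto
  have e: "V (Suc w) + Suc w - j - V j = (V w + w - j - V j) + Suc (vs (Suc w))" if "j \<in> {1..w}" for j
    using V[OF that] that unfolding VS atLeastAtMost_iff by arith
  have "(\<Prod>j\<in>{1..w}. (-1) ^ (vs j * (V (Suc w) + Suc w - j - V j)) * (\<Prod>m<vs j. 2 * (of_nat (l j) - of_nat m) * h)) =
    (\<Prod>j\<in>{1..w}. (-1) ^ (vs j * (V w + w - j - V j)) * (\<Prod>m<vs j. 2 * (of_nat (l j) - of_nat m) * h)) *
    (\<Prod>j\<in>{1..w}. (-1) ^ (vs j * Suc (vs (Suc w))) :: 'a)"
    unfolding prod.distrib[symmetric]
  proof (intro prod.cong refl)
    fix j assume "j \<in> {1..w}"
    then show "(-1) ^ (vs j * (V (Suc w) + Suc w - j - V j)) * (\<Prod>m<vs j. 2 * (of_nat (l j) - of_nat m) * h) =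
        (-1) ^ (vs j * (V w + w - j - V j)) * (\<Prod>m<vs j. 2 * (of_nat (l j) - of_nat m) * h) *
        ((-1) ^ (vs j * Suc (vs (Suc w))) :: 'a)"
      unfolding e[OF \<open>j \<in> {1..w}\<close>] distrib_left power_add by (simp only: ac_simps)
  qed
  also have "(\<Prod>j\<in>{1..w}. (-1) ^ (vs j * Suc (vs (Suc w))) :: 'a) = (-1) ^ (V w * Suc (vs (Suc w)))"
    by (simp only: power_sum[symmetric] V_def sum_distrib_right)
  finally show ?thesis
    unfolding prefactor_def V_def[symmetric] by (simp add: ac_simps)
qed

text \<open>
  The induction step applies \<open>column_zero_east\<close> with the rows of \<open>R\<close> frozen. Each of the \<open>V\<close> rows
  outside \<open>R\<close> then contributes \<open>k + 1\<close> factors whose signs are opposite to those in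
  \<open>weight_term_Suc\<close>, in accordance with \<open>prefactor_Suc\<close>.
\<close>
lemma grid_zero_east:
  assumes "distinct is" "length is = (\<Sum>s\<in>{1..w}. vs s)"
  shows "grid vs w (rows 0 is) = prefactor w vs * weight_sum w vs (set is)"
  using assms
proof (induction w arbitrary: "is")
  case 0
  have "block_partitions {} 0 vs = {\<lambda>_. undefined}"
    by (auto simp: block_partitions_def)
  then show ?case using 0 by (simp add: prefactor_def weight_sum_def weight_term_def)
next
  case (Suc w)
  define k where "k = vs (Suc w)"
  define S where "S = set is"
  define V where "V = (\<Sum>s\<in>{1..w}. vs s)"
  define u where "u j = y j - z (Suc w) - of_nat (l (Suc w)) * h" for j
  define A where "A R = (\<Prod>i\<in>R. \<Prod>c\<in>{1..w}. y i - z c + of_nat (l c) * h)" for R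
  define C where "C = (\<Prod>m<k. 2 * (of_nat (l (Suc w)) - of_nat m) * h)"
  have S: "finite S" "card S = V + k" using Suc.prems by (auto simp: S_def V_def k_def distinct_card)
  have "grid vs (Suc w) (rows 0 is) = C * (\<Sum>R | R \<subseteq> S \<and> card R = k.
      A R * (prefactor w vs * weight_sum w vs (S - R)) * (\<Prod>j\<in>S - R. u j * (\<Prod>r\<in>R. hop r j)))"
    unfolding grid.simps k_def[symmetric] C_def S_def u_def
  proof (rule column_zero_east[OF grid_exchange Suc.prems(1)])
    fix as bs assume as: "distinct (as @ bs)" "set (as @ bs) = set is" "length bs = k"
    then have "set is - set bs = set as" by auto
    moreover have "length as = V"
      using as S by (metis Diff_cancel S_def add_diff_cancel_right' distinct_card length_append)
    ultimately show "grid vs w (rows 0 as @ rows 1 bs) =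
        A (set bs) * (prefactor w vs * weight_sum w vs (set is - set bs))"
      using as Suc.IH[of as] by (simp add: grid_frozen_rows[unfolded One_nat_def] A_def V_def)
  qed
  also have "(\<Sum>R | R \<subseteq> S \<and> card R = k.
      A R * (prefactor w vs * weight_sum w vs (S - R)) * (\<Prod>j\<in>S - R. u j * (\<Prod>r\<in>R. hop r j))) =
    (\<Sum>R | R \<subseteq> S \<and> card R = k. prefactor w vs * (-1) ^ (V * Suc k) *
      (\<Sum>J\<in>block_partitions (S - R) w vs. weight_term (Suc w) (J(Suc w := R))))"
  proof (rule sum.cong[OF refl])
    fix R assume "R \<in> {R. R \<subseteq> S \<and> card R = k}"
    then have R: "R \<subseteq> S" "card R = k" "card (S - R) = V"
      using S by (auto simp: card_Diff_subset finite_subset)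
    have "(\<Prod>j\<in>S - R. - u j * (\<Prod>r\<in>R. - hop r j)) = (\<Prod>j\<in>S - R. (-1) ^ Suc k * (u j * (\<Prod>r\<in>R. hop r j)))"
      by (simp add: prod_uminus R ac_simps)
    also have "\<dots> = (-1) ^ (V * Suc k) * (\<Prod>j\<in>S - R. u j * (\<Prod>r\<in>R. hop r j))"
      unfolding prod.distrib prod_constant R(3) power_mult[symmetric] by (simp only: mult.commute[of V])
    finally have sgn: "(\<Prod>j\<in>S - R. - u j * (\<Prod>r\<in>R. - hop r j)) = \<dots>" .
    have "(-1) ^ (V * Suc k) * (-1) ^ (V * Suc k) = (1::'a)" by (simp flip: power_mult_distrib)
    then have sgn': "(\<Prod>j\<in>S - R. u j * (\<Prod>r\<in>R. hop r j)) =
        (-1) ^ (V * Suc k) * (\<Prod>j\<in>S - R. - u j * (\<Prod>r\<in>R. - hop r j))"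
      unfolding sgn by (simp only: mult.assoc[symmetric] mult_1_left)
    show "A R * (prefactor w vs * weight_sum w vs (S - R)) * (\<Prod>j\<in>S - R. u j * (\<Prod>r\<in>R. hop r j)) =
      prefactor w vs * (-1) ^ (V * Suc k) *
      (\<Sum>J\<in>block_partitions (S - R) w vs. weight_term (Suc w) (J(Suc w := R)))"
    proof -
      have "(\<Sum>J\<in>block_partitions (S - R) w vs. weight_term (Suc w) (J(Suc w := R))) =
          weight_sum w vs (S - R) * (\<Prod>j\<in>S - R. - u j * (\<Prod>r\<in>R. - hop r j)) * A R"
        unfolding weight_sum_def sum_distrib_right u_def A_def
        by (intro sum.cong refl weight_term_Suc[OF S(1) R(1)])
      then show ?thesis unfolding sgn' by (simp only: ac_simps)
    qed
  qed
  also have "C * \<dots> = prefactor (Suc w) vs * weight_sum (Suc w) vs S"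
    unfolding weight_sum_def sum_block_partitions_Suc[OF S(1)] prefactor_Suc k_def[symmetric]
      C_def[symmetric] V_def[symmetric] sum_distrib_left by (simp only: ac_simps)
  finally show ?case unfolding S_def .
qed

end

section \<open>States of the lattice and iterated columns\<close>
lemma PiE_insert_sum:
  assumes "x \<notin> S" "finite (T x)" "finite S" "\<And>i. i \<in> S \<Longrightarrow> finite (T i)"
  shows "(\<Sum>a\<in>Pi\<^sub>E (insert x S) T. F a) = (\<Sum>v\<in>T x. \<Sum>a\<in>Pi\<^sub>E S T. F (a(x := v)))"
proof -
  have "(\<Sum>a\<in>Pi\<^sub>E (insert x S) T. F a) = (\<Sum>(v, a)\<in>T x \<times> Pi\<^sub>E S T. F (a(x := v)))"
    unfolding PiE_insert_eq by (subst sum.reindex[OF inj_combinator[OF assms(1)]]) (simp add: case_prod_unfold)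
  then show ?thesis using assms by (simp add: sum.cartesian_product)
qed

context lattice_model begin

text \<open>
  The weight of a column between a West boundary \<open>a\<close> and an East boundary \<open>b\<close>; conservation at the
  vertices determines the vertical labels from the top label \<open>t\<close>. It unfolds the recursive sum in
  \<open>column\<close> into a sum over all West boundaries.
\<close>
fun path_weight :: "nat \<Rightarrow> (nat \<Rightarrow> nat) \<Rightarrow> (nat \<Rightarrow> nat) \<Rightarrow> nat \<Rightarrow> nat list \<Rightarrow> 'a" where
  "path_weight c b a t [] = (if t = 0 then 1 else 0)"
| "path_weight c b a t (i # is) = (if a i \<le> t + b i
     then wt c i (a i) (b i) t (t + b i - a i) * path_weight c b a (t + b i - a i) is else 0)"

lemma path_weight_cong:
  "(\<And>i. i \<in> set is \<Longrightarrow> a i = a' i) \<Longrightarrow> path_weight c b a t is = path_weight c b a' t is"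
  by (induction "is" arbitrary: t) auto

lemma column_eq_sum_paths:
  assumes "distinct is"
  shows "column c X t (map (\<lambda>i. (i, b i)) is) =
    (\<Sum>a\<in>set is \<rightarrow>\<^sub>E {0, 1}. path_weight c b a t is * X (map (\<lambda>i. (i, a i)) is))"
  using assms
proof (induction "is" arbitrary: X t)
  case (Cons i "is")
  then have i: "i \<notin> set is" by simp
  have upd: "path_weight c b (a(i := v)) n is = path_weight c b a n is"
    "map (\<lambda>j. (j, (a(i := v)) j)) is = map (\<lambda>j. (j, a j)) is" for a v n
    using i by (auto intro: path_weight_cong)
  have "column c X t (map (\<lambda>i. (i, b i)) (i # is)) = (\<Sum>v\<in>{0, 1}. if v \<le> t + b i
     then wt c i v (b i) t (t + b i - v) * (\<Sum>a\<in>set is \<rightarrow>\<^sub>E {0, 1}. path_weight c b a (t + b i - v) is *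
       X ((i, v) # map (\<lambda>i. (i, a i)) is)) else 0)"
    using Cons by (simp only: list.map column.simps distinct.simps)
  also have "\<dots> = (\<Sum>v\<in>{0, 1}. \<Sum>a\<in>set is \<rightarrow>\<^sub>E {0, 1}.
      path_weight c b (a(i := v)) t (i # is) * X (map (\<lambda>j. (j, (a(i := v)) j)) (i # is)))"
  proof (rule sum.cong[OF refl])
    fix v :: nat
    show "(if v \<le> t + b i
     then wt c i v (b i) t (t + b i - v) * (\<Sum>a\<in>set is \<rightarrow>\<^sub>E {0, 1}. path_weight c b a (t + b i - v) is *
       X ((i, v) # map (\<lambda>i. (i, a i)) is)) else 0) = (\<Sum>a\<in>set is \<rightarrow>\<^sub>E {0, 1}.
      path_weight c b (a(i := v)) t (i # is) * X (map (\<lambda>j. (j, (a(i := v)) j)) (i # is)))"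
      unfolding path_weight.simps list.map upd fun_upd_same
      by (simp add: sum_distrib_left mult.assoc)
  qed
  also have "\<dots> = (\<Sum>a\<in>set (i # is) \<rightarrow>\<^sub>E {0, 1}. path_weight c b a t (i # is) * X (map (\<lambda>j. (j, a j)) (i # is)))"
    unfolding list.set by (rule PiE_insert_sum[symmetric]) (use i in auto)
  finally show ?case .
qed simp

lemma path_weight_eq_prod:
  assumes "k \<le> v" "V v = 0" "\<And>i. i \<in> {Suc k..v} \<Longrightarrow> a i + V i = b i + V (i - 1)"
  shows "path_weight c b a (V k) [Suc k..<Suc v] = (\<Prod>i\<in>{Suc k..v}. wt c i (a i) (b i) (V (i - 1)) (V i))"
  using assms
proof (induction k rule: inc_induct)
  case (step k)
  have "[Suc k..<Suc v] = Suc k # [Suc (Suc k)..<Suc v]" "{Suc k..v} = insert (Suc k) {Suc (Suc k)..v}"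
    using step.hyps by (auto simp: upt_conv_Cons)
  moreover have "a (Suc k) \<le> V k + b (Suc k)" "V k + b (Suc k) - a (Suc k) = V (Suc k)"
    using step.prems(2)[of "Suc k"] step.hyps by auto
  ultimately show ?case using step.IH[OF step.prems(1)] step.prems(2) by simp
qed simp

text \<open>
  A path above the bound \<open>l c\<close> has to come down to \<open>0\<close>, and the step from \<open>l c + 1\<close> to \<open>l c\<close> has
  the weight \<open>2 * (l c - l c) * h = 0\<close>.
\<close>
lemma path_weight_exceed: "l c < t \<Longrightarrow> path_weight c b a t is = 0"
proof (induction "is" arbitrary: t)
  case (Cons i "is")
  show ?case
  proof (cases "l c < t + b i - a i")
    case True then show ?thesis using Cons.IH by simp
  next
    case False
    have "wt c i (a i) (b i) t (t + b i - a i) = 0"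
    proof (cases "a i = 1 \<and> b i = 0 \<and> t = Suc (l c)")
      case True
      then show ?thesis by (simp add: wt_def)
    next
      case not_top: False
      show ?thesis using False not_top Cons.prems unfolding wt_def by auto
    qed
    then show ?thesis by simp
  qed
qed simp

text \<open>
  For \<open>k = 0\<close> these are the conditions on the vertical labels of one column of a state; general \<open>k\<close>
  serves the recursion over the rows.
\<close>
definition column_labels :: "nat \<Rightarrow> nat \<Rightarrow> (nat \<Rightarrow> nat) \<Rightarrow> (nat \<Rightarrow> nat) \<Rightarrow> nat \<Rightarrow> nat \<Rightarrow> (nat \<Rightarrow> nat) \<Rightarrow> bool"
  where "column_labels c v b a t k V \<longleftrightarrow> V k = t \<and> V v = 0 \<and>
    (\<forall>i\<in>{Suc k..v}. a i + V i = b i + V (i - 1)) \<and> (\<forall>i\<in>{k..v}. V i \<le> l c)"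

lemma path_weight_nonzero:
  assumes "k \<le> v" "path_weight c b a t [Suc k..<Suc v] \<noteq> 0"
  shows "\<exists>V. column_labels c v b a t k V"
  using assms
proof (induction k arbitrary: t rule: inc_induct)
  case base
  then show ?case by (auto simp: column_labels_def split: if_splits intro!: exI[of _ "\<lambda>_. 0"])
next
  case (step k)
  define t' where "t' = t + b (Suc k) - a (Suc k)"
  have "[Suc k..<Suc v] = Suc k # [Suc (Suc k)..<Suc v]"
    using step.hyps by (auto simp: upt_conv_Cons)
  then have *: "a (Suc k) \<le> t + b (Suc k)" "path_weight c b a t' [Suc (Suc k)..<Suc v] \<noteq> 0"
    using step.prems by (auto simp: t'_def split: if_splits)
  from step.IH[OF *(2)] obtain V where V: "column_labels c v b a t' (Suc k) V" ..
  have "t \<le> l c" using path_weight_exceed step.prems by (meson not_le)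
  then have "column_labels c v b a t k (V(k := t))"
    using V * step.hyps unfolding column_labels_def t'_def
    by (auto simp: Suc_le_eq le_less)
  then show ?case by blast
qed

lemma column_labels_unique:
  assumes "column_labels c v b a t 0 V" "column_labels c v b a t 0 V'" "i \<le> v"
  shows "V i = V' i"
  using assms(3)
proof (induction i)
  case 0
  then show ?case using assms by (simp add: column_labels_def)
next
  case (Suc i)
  then have "Suc i \<in> {Suc 0..v}" by simp
  then have "a (Suc i) + V (Suc i) = b (Suc i) + V i" "a (Suc i) + V' (Suc i) = b (Suc i) + V' i"
    using assms(1,2) unfolding column_labels_def by (metis diff_Suc_1)+
  then show ?case using Suc by simp
qed

text \<open>
  The states with no condition on the East boundary: cutting a state between two columns produces
  a boundary with arbitrary labels.
\<close>
definition open_states :: "nat \<Rightarrow> nat \<Rightarrow> (nat \<Rightarrow> nat) \<Rightarrow> (edge \<Rightarrow> nat) set" where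
  "open_states v w vs = {c \<in> Pi\<^sub>E (edges v w) (labels l).
    (\<forall>j\<in>{1..w}. c (Vert v j) = 0) \<and>
    (\<forall>i\<in>{1..v}. c (Horiz i 0) = 1) \<and>
    (\<forall>j\<in>{1..w}. c (Vert 0 j) = vs j) \<and>
    (\<forall>i\<in>{1..v}. \<forall>j\<in>{1..w}.
      c (Horiz i (j - 1)) + c (Vert i j) = c (Horiz i j) + c (Vert (i - 1) j))}"

definition states_east :: "nat \<Rightarrow> nat \<Rightarrow> (nat \<Rightarrow> nat) \<Rightarrow> (nat \<Rightarrow> nat) \<Rightarrow> (edge \<Rightarrow> nat) set" where
  "states_east v w vs e = {c \<in> open_states v w vs. \<forall>i\<in>{1..v}. c (Horiz i w) = e i}"

definition weight :: "nat \<Rightarrow> nat \<Rightarrow> (edge \<Rightarrow> nat) \<Rightarrow> 'a" where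
  "weight v w c = (\<Prod>i\<in>{1..v}. \<Prod>j\<in>{1..w}.
    wt j i (c (Horiz i (j - 1))) (c (Horiz i j)) (c (Vert (i - 1) j)) (c (Vert i j)))"

lemma finite_edges: "finite (edges v w)"
proof -
  have "edges v w = (\<lambda>(i, j). Horiz i j) ` ({1..v} \<times> {0..w}) \<union> (\<lambda>(i, j). Vert i j) ` ({0..v} \<times> {1..w})"
    by (auto simp: edges_def)
  then show ?thesis by simp
qed

lemma finite_open_states: "finite (open_states v w vs)"
proof -
  have "finite (labels l e)" for e by (cases e) auto
  then have "finite (Pi\<^sub>E (edges v w) (labels l))" by (intro finite_PiE finite_edges)
  then show ?thesis by (rule rev_finite_subset) (auto simp: open_states_def)
qed

lemma edges_Suc: "edges v (Suc w) = edges v w \<union> {Horiz i (Suc w) | i. i \<in> {1..v}} \<union> {Vert i (Suc w) | i. i \<in> {0..v}}"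
  by (auto simp: edges_def le_Suc_eq)

text \<open>This undoes the restriction of a state to its first \<open>w\<close> columns.\<close>
definition glue :: "nat \<Rightarrow> nat \<Rightarrow> (nat \<Rightarrow> nat) \<Rightarrow> (nat \<Rightarrow> nat) \<Rightarrow> (edge \<Rightarrow> nat) \<Rightarrow> edge \<Rightarrow> nat" where
  "glue v w e V c x = (case x of
     Horiz i j \<Rightarrow> if j = Suc w \<and> i \<in> {1..v} then e i else c x
   | Vert i j \<Rightarrow> if j = Suc w \<and> i \<in> {0..v} then V i else c x)"

lemma Ball_Suc: "(\<forall>j\<in>{1..Suc w}. P j) \<longleftrightarrow> (\<forall>j\<in>{1..w}. P j) \<and> P (Suc w)"
proof -
  have "{1..Suc w} = insert (Suc w) {1..w}" by auto
  then show ?thesis by auto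
qed

lemma restrict_states_east:
  assumes "c \<in> states_east v (Suc w) vs e"
  shows "restrict c (edges v w) \<in> open_states v w vs"
    and "column_labels (Suc w) v e (\<lambda>i. c (Horiz i w)) (vs (Suc w)) 0 (\<lambda>i. c (Vert i (Suc w)))"
proof -
  have sub: "edges v w \<subseteq> edges v (Suc w)" by (auto simp: edges_Suc)
  have c: "c \<in> Pi\<^sub>E (edges v (Suc w)) (labels l)" using assms by (simp add: states_east_def open_states_def)
  then have "restrict c (edges v w) \<in> Pi\<^sub>E (edges v w) (labels l)" using sub by (auto simp: PiE_iff)
  moreover have "Vert i j \<in> edges v w" if "i \<in> {0..v}" "j \<in> {1..w}" for i j using that by (simp add: edges_def)
  moreover have "Horiz i j \<in> edges v w" if "i \<in> {1..v}" "j \<in> {0..w}" for i j using that by (simp add: edges_def)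
  ultimately show "restrict c (edges v w) \<in> open_states v w vs"
    using assms unfolding states_east_def open_states_def Ball_Suc by auto
  have "c (Vert i (Suc w)) \<le> l (Suc w)" if "i \<in> {0..v}" for i
    using that PiE_mem[OF c, of "Vert i (Suc w)"] by (auto simp: edges_def)
  then show "column_labels (Suc w) v e (\<lambda>i. c (Horiz i w)) (vs (Suc w)) 0 (\<lambda>i. c (Vert i (Suc w)))"
    using assms unfolding column_labels_def states_east_def open_states_def Ball_Suc by auto
qed

lemma glue_states_east:
  assumes c: "c \<in> open_states v w vs" and e: "e \<in> {1..v} \<rightarrow> {0, 1}"
    and V: "column_labels (Suc w) v e (\<lambda>i. c (Horiz i w)) (vs (Suc w)) 0 V"
  shows "glue v w e V c \<in> states_east v (Suc w) vs e"
    and "restrict (glue v w e V c) (edges v w) = c"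
proof -
  have c': "c \<in> Pi\<^sub>E (edges v w) (labels l)" using c by (simp add: open_states_def)
  have new: "glue v w e V c (Horiz i (Suc w)) = e i" "glue v w e V c (Vert i' (Suc w)) = V i'"
    if "i \<in> {1..v}" "i' \<in> {0..v}" for i i' using that by (auto simp: glue_def)
  have old: "glue v w e V c (Horiz i j) = c (Horiz i j)" "glue v w e V c (Vert i j) = c (Vert i j)"
    if "j \<le> w" for i j using that by (auto simp: glue_def)
  have oldE: "glue v w e V c x = c x" if "x \<in> edges v w" for x
    using that old by (auto simp: edges_def)
  show "restrict (glue v w e V c) (edges v w) = c"
    using c' oldE by (auto simp: fun_eq_iff restrict_def PiE_iff extensional_def)
  have "glue v w e V c \<in> Pi\<^sub>E (edges v (Suc w)) (labels l)"
  proof (rule PiE_I)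
    fix x assume "x \<in> edges v (Suc w)"
    then consider "x \<in> edges v w" | i where "x = Horiz i (Suc w)" "i \<in> {1..v}" | i where "x = Vert i (Suc w)" "i \<in> {0..v}"
      unfolding edges_Suc by blast
    then show "glue v w e V c x \<in> labels l x"
    proof cases
      case 1 then show ?thesis using c' oldE by (simp add: PiE_iff)
    next
      case 2 then show ?thesis using e by (auto simp: glue_def)
    next
      case 3 then show ?thesis using V by (auto simp: glue_def column_labels_def)
    qed
  next
    fix x assume x: "x \<notin> edges v (Suc w)"
    then have "glue v w e V c x = c x" by (cases x) (auto simp: glue_def edges_Suc)
    then show "glue v w e V c x = undefined" using c' x by (auto simp: PiE_iff extensional_def edges_Suc)
  qed
  moreover have "\<forall>j\<in>{1..w}. glue v w e V c (Vert v j) = 0 \<and> glue v w e V c (Vert 0 j) = vs j"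
    using c by (simp add: old open_states_def)
  moreover have "\<forall>i\<in>{1..v}. glue v w e V c (Horiz i 0) = 1"
    using c by (simp add: old open_states_def)
  moreover have "\<forall>i\<in>{1..v}. \<forall>j\<in>{1..w}. glue v w e V c (Horiz i (j - 1)) + glue v w e V c (Vert i j) =
      glue v w e V c (Horiz i j) + glue v w e V c (Vert (i - 1) j)"
    using c by (auto simp: old open_states_def)
  moreover have "\<forall>i\<in>{1..v}. glue v w e V c (Horiz i w) + glue v w e V c (Vert i (Suc w)) =
      glue v w e V c (Horiz i (Suc w)) + glue v w e V c (Vert (i - 1) (Suc w))"
    using V by (auto simp: old new column_labels_def)
  moreover have "glue v w e V c (Vert v (Suc w)) = 0" "glue v w e V c (Vert 0 (Suc w)) = vs (Suc w)"
    using V by (auto simp: new column_labels_def glue_def)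
  ultimately show "glue v w e V c \<in> states_east v (Suc w) vs e"
    unfolding states_east_def open_states_def Ball_Suc using new by auto
qed

text \<open>
  Restriction to the first \<open>w\<close> columns is a bijection onto those open states that admit vertical
  labels in the last column; these labels are unique. The other open states have path weight \<open>0\<close>.
\<close>
lemma sum_states_east_Suc:
  assumes e: "e \<in> {1..v} \<rightarrow> {0, 1}"
  shows "(\<Sum>c\<in>states_east v (Suc w) vs e. weight v (Suc w) c) =
    (\<Sum>c\<in>open_states v w vs. weight v w c *
      path_weight (Suc w) e (\<lambda>i. c (Horiz i w)) (vs (Suc w)) [1..<Suc v])"
proof -
  define L where "L c = column_labels (Suc w) v e (\<lambda>i. c (Horiz i w)) (vs (Suc w)) 0" for c
  let ?T = "{c \<in> open_states v w vs. \<nexists>V. L c V}"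
  let ?i = "\<lambda>c. glue v w e (SOME V. L c V) c" and ?j = "\<lambda>c. restrict c (edges v w)"
  show ?thesis
  proof (rule sum.reindex_bij_witness_not_neutral[where S' = "{}" and T' = ?T and i = ?i and j = ?j])
    show "finite ({} :: (edge \<Rightarrow> nat) set)" "finite ?T" using finite_open_states by simp_all
    fix c assume "c \<in> open_states v w vs - ?T"
    then have c: "c \<in> open_states v w vs" "L c (SOME V. L c V)" by (auto intro: someI_ex[of "L c"])
    show "?j (?i c) = c" "?i c \<in> states_east v (Suc w) vs e - {}"
      using glue_states_east[OF c(1) e c(2)[unfolded L_def]] by (simp_all add: L_def)
  next
    fix c assume c: "c \<in> states_east v (Suc w) vs e - {}"
    note r = restrict_states_east[of c v w vs e]
    have a: "restrict c (edges v w) (Horiz i w) = c (Horiz i w)" if "i \<in> {1..v}" for i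
      using that by (simp add: edges_def)
    have L: "L (?j c) (\<lambda>i. c (Vert i (Suc w)))"
      using r(2) c a unfolding L_def column_labels_def by auto
    then show "?j c \<in> open_states v w vs - ?T" using r(1) c by auto
    have some: "(SOME V. L (?j c) V) i = c (Vert i (Suc w))" if "i \<le> v" for i
      using column_labels_unique[OF someI[of "L (?j c)", OF L, unfolded L_def] L[unfolded L_def] that]
      unfolding L_def .
    have "c \<in> Pi\<^sub>E (edges v (Suc w)) (labels l)" using c by (simp add: states_east_def open_states_def)
    then have "?i (?j c) x = c x" for x
      using c some by (cases x)
        (auto simp: glue_def states_east_def edges_Suc PiE_iff extensional_def split: if_splits)
    then show "?i (?j c) = c" by (rule ext)
  next
    fix c assume c: "c \<in> states_east v (Suc w) vs e"
    note r = restrict_states_east[OF c]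
    define c' where "c' = ?j c"
    have eq: "c' (Horiz i j) = c (Horiz i j)" if "i \<in> {1..v}" "j \<in> {0..w}" for i j
      using that by (simp add: c'_def edges_def)
    have eqv: "c' (Vert i j) = c (Vert i j)" if "i \<in> {0..v}" "j \<in> {1..w}" for i j
      using that by (simp add: c'_def edges_def)
    have old: "weight v w c' = (\<Prod>i\<in>{1..v}. \<Prod>j\<in>{1..w}.
      wt j i (c (Horiz i (j - 1))) (c (Horiz i j)) (c (Vert (i - 1) j)) (c (Vert i j)))"
      unfolding weight_def
    proof (intro prod.cong refl)
      fix i j assume "i \<in> {1..v}" "j \<in> {1..w}"
      then have "c' (Horiz i (j - 1)) = c (Horiz i (j - 1))" "c' (Horiz i j) = c (Horiz i j)"
        "c' (Vert (i - 1) j) = c (Vert (i - 1) j)" "c' (Vert i j) = c (Vert i j)"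
        by (auto intro!: eq eqv)
      then show "wt j i (c' (Horiz i (j - 1))) (c' (Horiz i j)) (c' (Vert (i - 1) j)) (c' (Vert i j)) =
          wt j i (c (Horiz i (j - 1))) (c (Horiz i j)) (c (Vert (i - 1) j)) (c (Vert i j))" by simp
    qed
    have V: "c (Vert 0 (Suc w)) = vs (Suc w)" using c by (simp add: states_east_def open_states_def)
    have "path_weight (Suc w) e (\<lambda>i. c' (Horiz i w)) (vs (Suc w)) [1..<Suc v] =
        path_weight (Suc w) e (\<lambda>i. c (Horiz i w)) (c (Vert 0 (Suc w))) [Suc 0..<Suc v]"
      unfolding V One_nat_def by (rule path_weight_cong) (auto intro: eq)
    also have "\<dots> = (\<Prod>i\<in>{Suc 0..v}. wt (Suc w) i (c (Horiz i w)) (e i) (c (Vert (i - 1) (Suc w))) (c (Vert i (Suc w))))"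
      by (rule path_weight_eq_prod) (use r(2) in \<open>auto simp: column_labels_def\<close>)
    also have "\<dots> = (\<Prod>i\<in>{1..v}. wt (Suc w) i (c (Horiz i w)) (c (Horiz i (Suc w))) (c (Vert (i - 1) (Suc w))) (c (Vert i (Suc w))))"
      using c by (intro prod.cong) (auto simp: states_east_def)
    finally have new: "path_weight (Suc w) e (\<lambda>i. c' (Horiz i w)) (vs (Suc w)) [1..<Suc v] = \<dots>" .
    have "{1..Suc w} = insert (Suc w) {1..w}" by auto
    then show "weight v w (?j c) * path_weight (Suc w) e (\<lambda>i. ?j c (Horiz i w)) (vs (Suc w)) [1..<Suc v] = weight v (Suc w) c"
      unfolding c'_def[symmetric] old new by (simp add: weight_def prod.distrib mult.commute)
  next
    fix c :: "edge \<Rightarrow> nat" assume "c \<in> {}"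
    then show "weight v (Suc w) c = 0" by simp
  next
    fix c assume "c \<in> ?T"
    then have "path_weight (Suc w) e (\<lambda>i. c (Horiz i w)) (vs (Suc w)) [Suc 0..<Suc v] = 0"
      using path_weight_nonzero[of 0 v] unfolding L_def by blast
    then show "weight v w c * path_weight (Suc w) e (\<lambda>i. c (Horiz i w)) (vs (Suc w)) [1..<Suc v] = 0"
      by simp
  qed
qed

lemma sum_states_east:
  assumes "e \<in> {1..v} \<rightarrow> {0, 1}"
  shows "(\<Sum>c\<in>states_east v w vs e. weight v w c) = grid vs w (map (\<lambda>i. (i, e i)) [1..<Suc v])"
  using assms
proof (induction w arbitrary: e)
  case 0
  show ?case
  proof (cases "\<forall>i\<in>{1..v}. e i = 1")
    case True
    define c where "c = restrict (\<lambda>_. 1::nat) (edges v 0)"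
    have "c' = c" if "c' \<in> states_east v 0 vs e" for c'
      using that unfolding states_east_def open_states_def c_def
      by (auto simp: fun_eq_iff restrict_def PiE_iff extensional_def edges_def)
    moreover have "c \<in> states_east v 0 vs e"
      using True unfolding states_east_def open_states_def c_def
      by (auto simp: restrict_def PiE_iff extensional_def edges_def)
    ultimately have "states_east v 0 vs e = {c}" by blast
    then show ?thesis using True by (auto simp: weight_def simp del: upt_Suc)
  next
    case False
    then obtain i where i: "i \<in> {1..v}" "e i \<noteq> 1" by blast
    have "c \<notin> states_east v 0 vs e" for c
      using i by (auto simp: states_east_def open_states_def intro!: bexI[of _ i])
    then have "states_east v 0 vs e = {}" by blast
    then show ?thesis using False by (auto simp: image_iff)
  qed
next
  case (Suc w)
  let ?A = "{1..v} \<rightarrow>\<^sub>E {0, 1::nat}"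
  let ?west = "\<lambda>c. restrict (\<lambda>i. c (Horiz i w)) {1..v}"
  let ?p = "\<lambda>a. path_weight (Suc w) e a (vs (Suc w)) [1..<Suc v]"
  have "(\<Sum>c\<in>states_east v (Suc w) vs e. weight v (Suc w) c) =
      (\<Sum>c\<in>open_states v w vs. weight v w c * ?p (\<lambda>i. c (Horiz i w)))"
    by (rule sum_states_east_Suc[OF Suc.prems])
  also have "\<dots> = (\<Sum>c\<in>open_states v w vs. weight v w c * ?p (?west c))"
    by (intro sum.cong refl arg_cong2[where f = "(*)"] path_weight_cong) auto
  also have "\<dots> = (\<Sum>a\<in>?A. \<Sum>c\<in>{c \<in> open_states v w vs. ?west c = a}. weight v w c * ?p (?west c))"
  proof (rule sum.group[symmetric])
    show "finite (open_states v w vs)" by (rule finite_open_states)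
    show "finite ?A" by (intro finite_PiE) auto
    have bit: "c (Horiz i w) \<in> {0, 1}" if "c \<in> open_states v w vs" "i \<in> {1..v}" for c i
      using that PiE_mem[of c "edges v w" "labels l" "Horiz i w"] by (auto simp: open_states_def edges_def)
    show "?west ` open_states v w vs \<subseteq> ?A"
      by (intro image_subsetI restrict_PiE_iff[THEN iffD2] ballI bit)
  qed
  also have "\<dots> = (\<Sum>a\<in>?A. ?p a * grid vs w (map (\<lambda>i. (i, a i)) [1..<Suc v]))"
  proof (intro sum.cong refl)
    fix a assume a: "a \<in> ?A"
    have "{c \<in> open_states v w vs. ?west c = a} = states_east v w vs a"
      unfolding states_east_def using a
      by (intro Collect_cong conj_cong refl) (auto simp: fun_eq_iff PiE_iff extensional_def)
    moreover have "a \<in> {1..v} \<rightarrow> {0, 1}" using a by (auto simp: PiE_iff)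
    ultimately have "(\<Sum>c\<in>{c \<in> open_states v w vs. ?west c = a}. weight v w c) =
        grid vs w (map (\<lambda>i. (i, a i)) [1..<Suc v])"
      using Suc.IH by simp
    moreover have "(\<Sum>c\<in>{c \<in> open_states v w vs. ?west c = a}. weight v w c * ?p (?west c)) =
        (\<Sum>c\<in>{c \<in> open_states v w vs. ?west c = a}. weight v w c) * ?p a"
      unfolding sum_distrib_right by (intro sum.cong refl) simp
    ultimately show "(\<Sum>c\<in>{c \<in> open_states v w vs. ?west c = a}. weight v w c * ?p (?west c)) =
        ?p a * grid vs w (map (\<lambda>i. (i, a i)) [1..<Suc v])"
      by (simp only: mult.commute)
  qed
  also have "\<dots> = grid vs (Suc w) (map (\<lambda>i. (i, e i)) [1..<Suc v])"
  proof -
    have "set [1..<Suc v] = {1..v}" by auto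
    then show ?thesis by (simp only: grid.simps column_eq_sum_paths distinct_upt)
  qed
  finally show ?case .
qed

end

section \<open>Back to the polynomial ring\<close>
lemma of_nat_mpoly_fract_neq_0:
  assumes "n \<noteq> 0" shows "(of_nat n :: mpoly fract) \<noteq> 0"
proof -
  have "Poly_Mapping.lookup (of_nat n :: mpoly) 0 = of_nat n"
    by (metis lookup_single_eq single_of_nat)
  then have "(of_nat n :: mpoly) \<noteq> 0" using assms by auto
  moreover have "to_fract (of_nat n :: mpoly) = of_nat n" by (induction n) simp_all
  ultimately show ?thesis by (metis to_fract_eq_0_iff)
qed

lemma falling_factorial:
  fixes h :: "'a::field"
  assumes "k \<le> n" "\<And>m. m \<noteq> 0 \<Longrightarrow> (of_nat m :: 'a) \<noteq> 0"
  shows "(\<Prod>m<k. 2 * (of_nat n - of_nat m) * h) = (2 * h) ^ k * (of_nat (fact n) / of_nat (fact (n - k)))"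
  using assms(1)
proof (induction k)
  case 0
  have "(of_nat (fact n) :: 'a) \<noteq> 0" by (rule assms(2)) simp
  then show ?case by (simp del: of_nat_fact)
next
  case (Suc k)
  define r where "r = n - Suc k"
  have n: "n - k = Suc r" "n = k + Suc r" using Suc.prems by (auto simp: r_def)
  have ne: "(of_nat (Suc r) :: 'a) \<noteq> 0" "(of_nat (fact r) :: 'a) \<noteq> 0"
    by (rule assms(2), simp)+
  have "(of_nat (fact (Suc r)) :: 'a) = of_nat (Suc r) * of_nat (fact r)"
    by (simp only: fact_Suc of_nat_mult of_nat_id)
  moreover have "(of_nat n - of_nat k :: 'a) = of_nat (Suc r)"
    using n(2) by simp
  moreover have "q ^ k * (x / (s * p)) * (2 * s * h) = q ^ k * (2 * h) * (x / p)"
    if "s \<noteq> 0" for q x s p :: 'a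
    using that by (cases "p = 0") (simp_all add: field_simps)
  ultimately show ?case
    using Suc.IH Suc.prems ne unfolding r_def[symmetric]
    by (simp only: n(1) prod.lessThan_Suc power_Suc2 Suc_leD not_False_eq_True)
qed

theorem theorem2:
  fixes v w :: nat and l vs :: "nat \<Rightarrow> nat"
  assumes "\<And>j. j \<in> {1..w} \<Longrightarrow> 0 < l j"
    and "\<And>j. j \<in> {1..w} \<Longrightarrow> vs j \<le> l j"
    and "(\<Sum>j\<in>{1..w}. vs j) = v"
  shows "to_fract (partition_function v w l vs) =
    (\<Prod>j\<in>{1..w}. (-1) ^ (vs j * (v + w - j - (\<Sum>s\<in>{1..j}. vs s)))
        * to_fract (2 * hbar) ^ vs j
        * (of_nat (fact (l j)) / of_nat (fact (l j - vs j))))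
      * weight_function v w l vs"
proof -
  have nat: "to_fract (of_nat n :: mpoly) = of_nat n" for n by (induction n) simp_all
  have two: "to_fract (2 :: mpoly) = 2" using nat[of 2] by simp
  have prod: "to_fract (\<Prod>i\<in>A. F i) = (\<Prod>i\<in>A. to_fract (F i))" for F :: "nat \<Rightarrow> mpoly" and A
    by (induction A rule: infinite_finite_induct) simp_all
  \<comment> \<open>The row parameters are distinct because different indeterminates are different monomials.\<close>
  interpret lattice_model "to_fract hbar" "\<lambda>i. to_fract (yv i)" "\<lambda>j. to_fract (zv j)" l
  proof
    have "i = j" if "yv i = yv j" for i j
    proof -
      have "Poly_Mapping.lookup (yv i) (Poly_Mapping.single (Y i) 1) = 1" by (simp add: var_def)
      then have "Poly_Mapping.single (Y j) (1::nat) = Poly_Mapping.single (Y i) 1"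
        unfolding that by (simp add: var_def lookup_single when_def split: if_splits)
      then have "Poly_Mapping.lookup (Poly_Mapping.single (Y j) (1::nat)) (Y i) = 1" by simp
      then show ?thesis by (simp add: lookup_single when_def split: if_splits)
    qed
    then show "inj (\<lambda>i. to_fract (yv i))" by (auto intro: injI)
  qed
  have wt: "to_fract (vertex_weight (l j) a b t m (yv i - zv j)) = wt j i a b t m" for i j a b t m
    by (simp add: vertex_weight_def wt_def nat two)
  have "states v w l vs = states_east v w vs (\<lambda>_. 0)"
    by (auto simp: states_def states_east_def open_states_def)
  then have "to_fract (partition_function v w l vs) = (\<Sum>c\<in>states_east v w vs (\<lambda>_. 0). weight v w c)"
    by (simp add: partition_function_def state_weight_def weight_def prod wt)
  also have "\<dots> = prefactor w vs * weight_sum w vs {1..v}"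
  proof -
    have "set [1..<Suc v] = {1..v}" "length [1..<Suc v] = (\<Sum>s\<in>{1..w}. vs s)"
      using assms(3) by auto
    then show ?thesis
      using sum_states_east[of "\<lambda>_. 0" v w vs] grid_zero_east[of "[1..<Suc v]" vs w]
      by (simp del: upt_Suc)
  qed
  also have "weight_sum w vs {1..v} = weight_function v w l vs"
    unfolding weight_sum_def weight_function_def weight_term_def block_partitions_def
      ordered_set_partitions_def by (simp add: nat two)
  also have "prefactor w vs = (\<Prod>j\<in>{1..w}. (-1) ^ (vs j * (v + w - j - (\<Sum>s\<in>{1..j}. vs s)))
        * to_fract (2 * hbar) ^ vs j * (of_nat (fact (l j)) / of_nat (fact (l j - vs j))))"
    unfolding prefactor_def assms(3)
  proof (rule prod.cong[OF refl])
    fix j assume "j \<in> {1..w}"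
    then have "(\<Prod>m<vs j. 2 * (of_nat (l j) - of_nat m) * to_fract hbar) =
        to_fract (2 * hbar) ^ vs j * (of_nat (fact (l j)) / of_nat (fact (l j - vs j)))"
      unfolding to_fract_mult two
      by (intro falling_factorial assms(2) of_nat_mpoly_fract_neq_0)
    then show "(-1) ^ (vs j * (v + w - j - (\<Sum>s\<in>{1..j}. vs s))) *
          (\<Prod>m<vs j. 2 * (of_nat (l j) - of_nat m) * to_fract hbar) =
        (-1) ^ (vs j * (v + w - j - (\<Sum>s\<in>{1..j}. vs s))) * to_fract (2 * hbar) ^ vs j *
          (of_nat (fact (l j)) / of_nat (fact (l j - vs j)))"
      by (simp only: mult.assoc)
  qed
  finally show ?thesis .
qed

end
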